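(* Let $\Gamma\subset\mathbb{R}^d$ be a regular trajectory and let $\Omega\subset\mathbb{R}^d$ be a bounded (measurable) set of positive Lebesgue measure. Then $\Gamma$ is a sampling trajectory for $PW^2(\Omega)$ if and only if there exists a set $\Lambda\subset\Gamma$ that is a sampling set for $PW^2(\Omega)$. Moreover, $\Lambda$ can always be chosen to be separated.
   Context: A curve is a measurable map $\gamma:\mathbb{R}\to\mathbb{R}^d$ (not required to be continuous), and a trajectory is the image $\Gamma=\gamma(\mathbb{R})$ of a curve. $\mu_\Gamma$ denotes the restriction of the one-dimensional Hausdorff measure to $\Gamma$, i.e. $\mu_\Gamma(E)=\mathcal{H}^1(E\cap\Gamma)$ for Borel $E$. $\Gamma$ is regular if there exists $r_0>0$ such that $\sup_{x\in\mathbb{R}^d}\mu_\Gamma(B_{r_0}(x))<\infty$ and, for every $0<r\leq r_0$, there is $c_r>0$ with $\inf_{x\in\Gamma}\mu_\Gamma(B_r(x))\geq c_r$; here $B_r(x)$ is the open Euclidean ball. $PW^2(\Omega)$ is the space of Fourier transforms of functions in $L^2(\mathbb{R}^d)$ vanishing a.e. outside $\Omega$ (identified with their continuous representatives). $\Gamma$ is a sampling trajectory for $PW^2(\Omega)$ if there are $A,B>0$ with $A\|f\|_2^2\leq\int_\Gamma|f|^2\,d\mathcal{H}^1\leq B\|f\|_2^2$ for all $f\in PW^2(\Omega)$. A set $\Lambda\subset\mathbb{R}^d$ is a sampling set for $PW^2(\Omega)$ if there are $A,B>0$ with $A\|f\|_2^2\leq\sum_{\lambda\in\Lambda}|f(\lambda)|^2\leq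 B\|f\|_2^2$ for all $f\in PW^2(\Omega)$. $\Lambda$ is separated if $\inf\{|\lambda-\lambda'|:\lambda,\lambda'\in\Lambda,\lambda\neq\lambda'\}>0$. *)

theory Defs
  imports "HOL-Analysis.Analysis"
begin

definition hausdorff1_pre :: "real \<Rightarrow> 'a::metric_space set \<Rightarrow> ennreal" where
  "hausdorff1_pre \<delta> A =
     (INF U \<in> {U :: nat \<Rightarrow> 'a set. A \<subseteq> (\<Union>i. U i) \<and> (\<forall>i. bounded (U i) \<and> diameter (U i) \<le> \<delta>)}.
        \<Sum>i. ennreal (diameter (U i)))"

definition hausdorff1 :: "'a::metric_space set \<Rightarrow> ennreal" where
  "hausdorff1 A = (SUP \<delta>\<in>{0<..}. hausdorff1_pre \<delta> A)"

text \<open>For an arbitrary set \<open>\<Gamma>\<close>, the map \<open>E \<mapsto> hausdorff1 (E \<inter> \<Gamma>)\<close> is countably additive on the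
  Borel sets, so no measurability of \<open>\<Gamma>\<close> is needed; see \<open>emeasure_traj_measure\<close> below.\<close>

definition traj_measure :: "'a::metric_space set \<Rightarrow> 'a measure" where
  "traj_measure \<Gamma> = measure_of UNIV (sets borel) (\<lambda>E. hausdorff1 (E \<inter> \<Gamma>))"

lemma space_traj_measure [simp]: "space (traj_measure \<Gamma>) = UNIV"
  by (simp add: traj_measure_def space_measure_of_conv)

lemma sets_traj_measure [simp, measurable_cong]: "sets (traj_measure \<Gamma>) = sets borel"
  unfolding traj_measure_def
  by (metis sets.sets_measure_of_eq space_borel)

lemma hausdorff1_pre_le:
  assumes "A \<subseteq> (\<Union>i. U i)" "\<And>i. bounded (U i)" "\<And>i. diameter (U i) \<le> \<delta>"
  shows "hausdorff1_pre \<delta> A \<le> (\<Sum>i. ennreal (diameter (U i)))"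
  unfolding hausdorff1_pre_def using assms by (intro INF_lower) auto

lemma hausdorff1_pre_mono: "A \<subseteq> B \<Longrightarrow> hausdorff1_pre \<delta> A \<le> hausdorff1_pre \<delta> B"
  unfolding hausdorff1_pre_def by (rule INF_superset_mono) auto

lemma hausdorff1_pre_antimono: "\<delta> \<le> \<epsilon> \<Longrightarrow> hausdorff1_pre \<epsilon> A \<le> hausdorff1_pre \<delta> A"
  unfolding hausdorff1_pre_def by (rule INF_superset_mono) (auto intro: order_trans)

lemma hausdorff1_mono: "A \<subseteq> B \<Longrightarrow> hausdorff1 A \<le> hausdorff1 B"
  unfolding hausdorff1_def by (intro SUP_mono') (rule hausdorff1_pre_mono)

lemma hausdorff1_pre_le_hausdorff1: "\<delta> > 0 \<Longrightarrow> hausdorff1_pre \<delta> A \<le> hausdorff1 A"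
  unfolding hausdorff1_def by (rule SUP_upper) auto

lemma hausdorff1_empty [simp]: "hausdorff1 {} = 0"
proof -
  have "hausdorff1_pre \<delta> ({}::'a set) = 0" if "\<delta> > 0" for \<delta>
    using hausdorff1_pre_le[of "{}::'a set" "\<lambda>_. {}" \<delta>] that by auto
  then show ?thesis by (auto simp: hausdorff1_def)
qed

lemma hausdorff1_pre_countably_subadditive:
  "hausdorff1_pre \<delta> (\<Union>n. A n) \<le> (\<Sum>n::nat. hausdorff1_pre \<delta> (A n))"
proof (rule ennreal_le_epsilon)
  fix e :: real
  assume fin: "(\<Sum>n. hausdorff1_pre \<delta> (A n)) < top" and e: "0 < e"
  let ?P = "\<lambda>n U. A n \<subseteq> (\<Union>i. U i) \<and> (\<forall>i::nat. bounded (U i) \<and> diameter (U i) \<le> \<delta>) \<and>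
      (\<Sum>i. ennreal (diameter (U i))) \<le> hausdorff1_pre \<delta> (A n) + ennreal (e * (1/2)^Suc n)"
  have "\<exists>U. ?P n U" for n
  proof -
    have "hausdorff1_pre \<delta> (A n) < top"
      using ennreal_suminf_lessD[OF fin] by blast
    then have "hausdorff1_pre \<delta> (A n) < hausdorff1_pre \<delta> (A n) + ennreal (e * (1/2)^Suc n)"
      using e by (simp add: ennreal_zero_less_mult_iff ennreal_mult)
    then show ?thesis
      unfolding hausdorff1_pre_def[of \<delta> "A n"] INF_less_iff by (auto intro: less_imp_le)
  qed
  then obtain U where U: "\<And>n. ?P n (U n)" by metis
  define V where "V = (\<lambda>k. case prod_decode k of (n, i) \<Rightarrow> U n i)"
  have "(\<Union>n. A n) \<subseteq> (\<Union>k. V k)"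
  proof
    fix x assume "x \<in> (\<Union>n. A n)"
    then obtain n i where "x \<in> U n i" using U by blast
    then have "x \<in> V (prod_encode (n, i))" by (simp add: V_def)
    then show "x \<in> (\<Union>k. V k)" by blast
  qed
  then have "hausdorff1_pre \<delta> (\<Union>n. A n) \<le> (\<Sum>k. ennreal (diameter (V k)))"
    using U by (intro hausdorff1_pre_le) (auto simp: V_def split: prod.split)
  also have "\<dots> = (\<Sum>n. \<Sum>i. ennreal (diameter (U n i)))"
    using suminf_ennreal_2dimen[of "\<lambda>n. \<Sum>i. ennreal (diameter (U n i))" "\<lambda>(n,i). ennreal (diameter (U n i))"]
    by (simp add: V_def comp_def prod.case_eq_if)
  also have "\<dots> \<le> (\<Sum>n. hausdorff1_pre \<delta> (A n) + ennreal (e * (1/2)^Suc n))"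
    using U by (intro suminf_le) auto
  also have "\<dots> = (\<Sum>n. hausdorff1_pre \<delta> (A n)) + (\<Sum>n. ennreal (e * (1/2)^Suc n))"
    by (intro suminf_add[symmetric]) auto
  also have "(\<Sum>n. ennreal (e * (1/2)^Suc n)) = ennreal e"
    using e sums_mult[OF power_half_series, of e] by (intro suminf_ennreal_eq) auto
  finally show "hausdorff1_pre \<delta> (\<Union>n. A n) \<le> (\<Sum>n. hausdorff1_pre \<delta> (A n)) + ennreal e" .
qed

lemma hausdorff1_countably_subadditive: "hausdorff1 (\<Union>n. A n) \<le> (\<Sum>n::nat. hausdorff1 (A n))"
  unfolding hausdorff1_def[of "\<Union>n. A n"]
proof (rule SUP_least)
  fix \<delta> :: real assume "\<delta> \<in> {0<..}"
  then show "hausdorff1_pre \<delta> (\<Union>n. A n) \<le> (\<Sum>n. hausdorff1 (A n))"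
    by (intro order_trans[OF hausdorff1_pre_countably_subadditive] suminf_le)
       (auto intro: hausdorff1_pre_le_hausdorff1)
qed

lemma hausdorff1_Un_le: "hausdorff1 (A \<union> B) \<le> hausdorff1 A + hausdorff1 B"
proof -
  have "hausdorff1 (A \<union> B) \<le> hausdorff1 (\<Union>n. case n of 0 \<Rightarrow> A | Suc 0 \<Rightarrow> B | _ \<Rightarrow> {})"
    by (intro hausdorff1_mono) (force split: nat.splits)
  also have "\<dots> \<le> (\<Sum>n. hausdorff1 (case n of 0 \<Rightarrow> A | Suc 0 \<Rightarrow> B | _ \<Rightarrow> {}))"
    by (rule hausdorff1_countably_subadditive)
  also have "\<dots> = (\<Sum>n\<in>{0,1}. hausdorff1 (case n of 0 \<Rightarrow> A | Suc 0 \<Rightarrow> B | _ \<Rightarrow> {}))"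
    by (intro suminf_finite) (auto split: nat.splits)
  finally show ?thesis by simp
qed

lemma hausdorff1_Un_separated:
  assumes e: "e > 0" and sep: "\<And>x y. x \<in> A \<Longrightarrow> y \<in> B \<Longrightarrow> e \<le> dist x y"
  shows "hausdorff1 A + hausdorff1 B \<le> hausdorff1 (A \<union> B)"
proof -
  have pre: "hausdorff1_pre \<delta> A + hausdorff1_pre \<delta> B \<le> hausdorff1_pre \<delta> (A \<union> B)"
    if \<delta>: "0 < \<delta>" "\<delta> < e" for \<delta>
    unfolding hausdorff1_pre_def[of \<delta> "A \<union> B"]
  proof (rule INF_greatest)
    fix U :: "nat \<Rightarrow> 'a set"
    assume "U \<in> {U. A \<union> B \<subseteq> (\<Union>i. U i) \<and> (\<forall>i. bounded (U i) \<and> diameter (U i) \<le> \<delta>)}"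
    then have cov: "A \<union> B \<subseteq> (\<Union>i. U i)" and bd: "\<And>i. bounded (U i)"
      and di: "\<And>i. diameter (U i) \<le> \<delta>" by auto
    have sub: "diameter (U i \<inter> C) \<le> diameter (U i)" for i C
      using bd by (intro diameter_subset) auto
    have one: "U i \<inter> A = {} \<or> U i \<inter> B = {}" for i
    proof (rule ccontr)
      assume "\<not> ?thesis"
      then obtain x y where "x \<in> U i" "x \<in> A" "y \<in> U i" "y \<in> B" by blast
      then have "e \<le> diameter (U i)"
        using sep[of x y] diameter_bounded_bound[OF bd[of i], of x y] by linarith
      then show False using di[of i] \<delta> by linarith
    qed
    have "hausdorff1_pre \<delta> A \<le> (\<Sum>i. ennreal (diameter (U i \<inter> A)))"
      using cov bd order_trans[OF sub di] by (intro hausdorff1_pre_le) auto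
    moreover have "hausdorff1_pre \<delta> B \<le> (\<Sum>i. ennreal (diameter (U i \<inter> B)))"
      using cov bd order_trans[OF sub di] by (intro hausdorff1_pre_le) auto
    ultimately have "hausdorff1_pre \<delta> A + hausdorff1_pre \<delta> B
        \<le> (\<Sum>i. ennreal (diameter (U i \<inter> A))) + (\<Sum>i. ennreal (diameter (U i \<inter> B)))"
      by (rule add_mono)
    also have "\<dots> = (\<Sum>i. ennreal (diameter (U i \<inter> A)) + ennreal (diameter (U i \<inter> B)))"
      by (intro suminf_add) auto
    also have "\<dots> \<le> (\<Sum>i. ennreal (diameter (U i)))"
    proof (intro suminf_le)
      fix i
      show "ennreal (diameter (U i \<inter> A)) + ennreal (diameter (U i \<inter> B)) \<le> ennreal (diameter (U i))"
        using one[of i] ennreal_leI[OF sub[of i A]] ennreal_leI[OF sub[of i B]] by auto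
    qed auto
    finally show "hausdorff1_pre \<delta> A + hausdorff1_pre \<delta> B \<le> (\<Sum>i. ennreal (diameter (U i)))" .
  qed
  have "hausdorff1 A + hausdorff1 B
      = (SUP \<delta>\<in>{0<..}. hausdorff1_pre \<delta> A + hausdorff1_pre \<delta> B)"
    unfolding hausdorff1_def
  proof (rule SUP_add_directed_ennreal[symmetric])
    fix i j :: real assume "i \<in> {0<..}" "j \<in> {0<..}"
    then show "\<exists>k\<in>{0<..}. hausdorff1_pre i A + hausdorff1_pre j B
        \<le> hausdorff1_pre k A + hausdorff1_pre k B"
      by (intro bexI[of _ "min i j"] add_mono hausdorff1_pre_antimono) auto
  qed
  also have "\<dots> \<le> hausdorff1 (A \<union> B)"
  proof (rule SUP_least)
    fix \<delta> :: real assume \<delta>: "\<delta> \<in> {0<..}"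
    define \<eta> where "\<eta> = min \<delta> (e/2)"
    have \<eta>: "0 < \<eta>" "\<eta> < e" "\<eta> \<le> \<delta>" using \<delta> e by (auto simp: \<eta>_def)
    have "hausdorff1_pre \<delta> A + hausdorff1_pre \<delta> B \<le> hausdorff1_pre \<eta> A + hausdorff1_pre \<eta> B"
      by (intro add_mono hausdorff1_pre_antimono \<eta>)
    also have "\<dots> \<le> hausdorff1_pre \<eta> (A \<union> B)" by (rule pre) fact+
    also have "\<dots> \<le> hausdorff1 (A \<union> B)" by (rule hausdorff1_pre_le_hausdorff1) fact
    finally show "hausdorff1_pre \<delta> A + hausdorff1_pre \<delta> B \<le> hausdorff1 (A \<union> B)" .
  qed
  finally show ?thesis .
qed

lemma hausdorff1_closed_split:
  fixes C :: "'a::metric_space set"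
  assumes C: "closed C"
  shows "hausdorff1 (A \<inter> C) + hausdorff1 (A - C) = hausdorff1 A"
proof (rule antisym)
  have "hausdorff1 A \<le> hausdorff1 ((A \<inter> C) \<union> (A - C))" by (intro hausdorff1_mono) auto
  also have "\<dots> \<le> hausdorff1 (A \<inter> C) + hausdorff1 (A - C)" by (rule hausdorff1_Un_le)
  finally show "hausdorff1 A \<le> hausdorff1 (A \<inter> C) + hausdorff1 (A - C)" .
next
  show "hausdorff1 (A \<inter> C) + hausdorff1 (A - C) \<le> hausdorff1 A"
  proof (cases "hausdorff1 A = top \<or> C = {}")
    case True
    then show ?thesis by auto
  next
    case False
    then have fin: "hausdorff1 A < top" and ne: "C \<noteq> {}" by (auto simp: top.not_eq_extremum)
    define K where "K n = {x \<in> A. 1 / real (Suc n) \<le> infdist x C}" for n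
    define R where "R n = {x \<in> A. 1 / real (Suc (Suc n)) \<le> infdist x C \<and> infdist x C < 1 / real (Suc n)}" for n
    have near: "infdist x C \<le> infdist y C + dist x y" for x y
      by (rule infdist_triangle)
    have sumR: "(\<Sum>i<N. hausdorff1 (R (2 * i + k))) \<le> hausdorff1 (\<Union>i<N. R (2 * i + k))" for N k
    proof (induction N)
      case (Suc N)
      show ?case
      proof (cases "N = 0")
        case False
        define e where "e = 1 / real (2 * N + k) - 1 / real (Suc (2 * N + k))"
        have "1 / real (Suc (2 * N + k)) < 1 / real (2 * N + k)"
          using False by (intro divide_strict_left_mono) auto
        then have "e > 0" by (simp add: e_def)
        have sep: "e \<le> dist x y" if x: "x \<in> (\<Union>i<N. R (2 * i + k))" and y: "y \<in> R (2 * N + k)" for x y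
        proof -
          obtain i where "i < N" "x \<in> R (2 * i + k)" using x by blast
          then have "1 / real (Suc (Suc (2 * i + k))) \<le> infdist x C" by (simp add: R_def)
          moreover have "1 / real (2 * N + k) \<le> 1 / real (Suc (Suc (2 * i + k)))"
            using \<open>i < N\<close> by (intro divide_left_mono) auto
          moreover have "infdist y C < 1 / real (Suc (2 * N + k))" using y by (simp add: R_def)
          ultimately show ?thesis using near[of x y] unfolding e_def by linarith
        qed
        have "(\<Sum>i<Suc N. hausdorff1 (R (2 * i + k)))
            \<le> hausdorff1 (\<Union>i<N. R (2 * i + k)) + hausdorff1 (R (2 * N + k))"
          using Suc.IH by (simp add: add_right_mono)
        also have "\<dots> \<le> hausdorff1 ((\<Union>i<N. R (2 * i + k)) \<union> R (2 * N + k))"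
          using hausdorff1_Un_separated[OF \<open>e > 0\<close> sep] .
        also have "(\<Union>i<N. R (2 * i + k)) \<union> R (2 * N + k) = (\<Union>i<Suc N. R (2 * i + k))"
          by (auto simp: lessThan_Suc)
        finally show ?thesis .
      qed (simp add: lessThan_Suc)
    qed simp
    have subR: "hausdorff1 (\<Union>i<N. R (2 * i + k)) \<le> hausdorff1 A" for N k
      by (rule hausdorff1_mono) (auto simp: R_def)
    have split2: "(\<Sum>i<2 * N. hausdorff1 (R i))
        = (\<Sum>i<N. hausdorff1 (R (2 * i + 0))) + (\<Sum>i<N. hausdorff1 (R (2 * i + 1)))" for N
      by (induction N) (simp_all add: add_ac)
    have part: "(\<Sum>i<N. hausdorff1 (R i)) \<le> hausdorff1 A + hausdorff1 A" for N
    proof -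
      have "(\<Sum>i<N. hausdorff1 (R i)) \<le> (\<Sum>i<2 * N. hausdorff1 (R i))"
        by (intro sum_mono2) auto
      also have "\<dots> \<le> hausdorff1 A + hausdorff1 A"
        unfolding split2 by (intro add_mono order_trans[OF sumR subR])
      finally show ?thesis .
    qed
    define S where "S = (\<Sum>i. hausdorff1 (R i))"
    have "S \<le> hausdorff1 A + hausdorff1 A"
      unfolding S_def by (intro suminf_le_const part summableI)
    then have Sfin: "S < top" using fin by (simp add: le_less_trans)
    have cover: "A - C \<subseteq> K n \<union> (\<Union>i. R (i + n))" for n
    proof
      fix x assume x: "x \<in> A - C"
      then have "infdist x C \<noteq> 0" using in_closed_iff_infdist_zero[OF C ne] by auto
      then have pos: "infdist x C > 0" using infdist_nonneg[of x C] by linarith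
      obtain m0 where "1 / real (Suc m0) < infdist x C"
        using nat_approx_posE[OF pos] by blast
      then have ex: "\<exists>m. 1 / real (Suc m) \<le> infdist x C" by (auto intro: less_imp_le)
      define m where "m = (LEAST m. 1 / real (Suc m) \<le> infdist x C)"
      have m: "1 / real (Suc m) \<le> infdist x C" unfolding m_def using ex by (rule LeastI_ex)
      show "x \<in> K n \<union> (\<Union>i. R (i + n))"
      proof (cases "m \<le> n")
        case True
        then have "1 / real (Suc n) \<le> 1 / real (Suc m)" by (intro divide_left_mono) auto
        then show ?thesis using m x by (auto simp: K_def)
      next
        case False
        then obtain j where j: "m = Suc j" "n \<le> j" by (cases m) auto
        have "\<not> 1 / real (Suc j) \<le> infdist x C"
          using not_less_Least[of j "\<lambda>m. 1 / real (Suc m) \<le> infdist x C"] j(1) unfolding m_def by simp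
        then have "x \<in> R j" using m x j by (simp add: R_def)
        then have "x \<in> R ((j - n) + n)" using j by simp
        then show ?thesis by blast
      qed
    qed
    have "(hausdorff1 (A \<inter> C) + hausdorff1 (A - C)) + (\<Sum>i<n. hausdorff1 (R i)) \<le> hausdorff1 A + S" for n
    proof -
      have "hausdorff1 (A - C) \<le> hausdorff1 (K n \<union> (\<Union>i. R (i + n)))"
        by (intro hausdorff1_mono cover)
      also have "\<dots> \<le> hausdorff1 (K n) + (\<Sum>i. hausdorff1 (R (i + n)))"
        by (intro order_trans[OF hausdorff1_Un_le] add_mono hausdorff1_countably_subadditive order_refl)
      finally have 1: "hausdorff1 (A - C) \<le> hausdorff1 (K n) + (\<Sum>i. hausdorff1 (R (i + n)))" .
      have "1 / real (Suc n) \<le> dist x y" if "x \<in> A \<inter> C" "y \<in> K n" for x y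
        using that near[of y x] by (auto simp: K_def dist_commute)
      then have "hausdorff1 (A \<inter> C) + hausdorff1 (K n) \<le> hausdorff1 ((A \<inter> C) \<union> K n)"
        by (intro hausdorff1_Un_separated[of "1 / real (Suc n)"]) auto
      also have "\<dots> \<le> hausdorff1 A" by (intro hausdorff1_mono) (auto simp: K_def)
      finally have 2: "hausdorff1 (A \<inter> C) + hausdorff1 (K n) \<le> hausdorff1 A" .
      have 3: "S = (\<Sum>i. hausdorff1 (R (i + n))) + (\<Sum>i<n. hausdorff1 (R i))"
        unfolding S_def by (rule suminf_offset) (rule summableI)
      have "hausdorff1 (A \<inter> C) + hausdorff1 (A - C) + (\<Sum>i<n. hausdorff1 (R i))
          \<le> hausdorff1 (A \<inter> C) + (hausdorff1 (K n) + (\<Sum>i. hausdorff1 (R (i + n)))) + (\<Sum>i<n. hausdorff1 (R i))"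
        using 1 by (intro add_mono order_refl)
      also have "\<dots> = (hausdorff1 (A \<inter> C) + hausdorff1 (K n)) + S"
        unfolding 3 by (simp add: add_ac)
      also have "\<dots> \<le> hausdorff1 A + S" using 2 by (intro add_mono order_refl)
      finally show ?thesis .
    qed
    moreover have "(\<lambda>n. (hausdorff1 (A \<inter> C) + hausdorff1 (A - C)) + (\<Sum>i<n. hausdorff1 (R i)))
        \<longlonglongrightarrow> (hausdorff1 (A \<inter> C) + hausdorff1 (A - C)) + S"
      unfolding S_def by (intro tendsto_add tendsto_const summable_LIMSEQ summableI)
    ultimately have "(hausdorff1 (A \<inter> C) + hausdorff1 (A - C)) + S \<le> hausdorff1 A + S"
      by (intro LIMSEQ_le_const2) auto
    then show ?thesis using Sfin by (auto simp: ennreal_add_left_cancel_le add.commute[of _ S])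
  qed
qed

lemma measure_space_hausdorff1:
  "measure_space (UNIV :: 'a::metric_space set) (sets borel) (\<lambda>E. hausdorff1 (E \<inter> \<Gamma>))"
proof -
  let ?f = "\<lambda>E :: 'a set. hausdorff1 (E \<inter> \<Gamma>)"
  interpret P: sigma_algebra UNIV "Pow (UNIV :: 'a set)" by (rule sigma_algebra_Pow)
  have om: "outer_measure_space (Pow UNIV) ?f"
    unfolding outer_measure_space_def
  proof (intro conjI)
    show "countably_subadditive (Pow UNIV) ?f"
      unfolding countably_subadditive_def
    proof (intro allI impI)
      fix A :: "nat \<Rightarrow> 'a set"
      have "(\<Union>i. A i) \<inter> \<Gamma> = (\<Union>i. A i \<inter> \<Gamma>)" by blast
      then show "?f (\<Union>i. A i) \<le> (\<Sum>i. ?f (A i))"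
        using hausdorff1_countably_subadditive[of "\<lambda>i. A i \<inter> \<Gamma>"] by simp
    qed
  qed (auto simp: positive_def increasing_def intro!: hausdorff1_mono)
  have ms: "measure_space UNIV (lambda_system UNIV (Pow UNIV) ?f) ?f"
    by (rule P.caratheodory_lemma[OF om])
  then have sa: "sigma_algebra UNIV (lambda_system UNIV (Pow UNIV) ?f)"
    by (simp add: measure_space_def)
  have cl: "Collect closed \<subseteq> lambda_system UNIV (Pow UNIV) ?f"
  proof
    fix C :: "'a set" assume "C \<in> Collect closed"
    then have "hausdorff1 ((x \<inter> \<Gamma>) \<inter> C) + hausdorff1 ((x \<inter> \<Gamma>) - C) = hausdorff1 (x \<inter> \<Gamma>)" for x
      by (intro hausdorff1_closed_split) auto
    moreover have "C \<inter> x \<inter> \<Gamma> = x \<inter> \<Gamma> \<inter> C" "(UNIV - C) \<inter> x \<inter> \<Gamma> = x \<inter> \<Gamma> - C" for x by auto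
    ultimately show "C \<in> lambda_system UNIV (Pow UNIV) ?f"
      by (simp add: lambda_system_def)
  qed
  have "sets (borel :: 'a measure) = sigma_sets UNIV (Collect closed)"
    by (simp add: borel_eq_closed)
  also have "\<dots> \<subseteq> lambda_system UNIV (Pow UNIV) ?f"
    by (rule sigma_algebra.sigma_sets_subset[OF sa cl])
  finally have sub: "sets borel \<subseteq> lambda_system UNIV (Pow UNIV) ?f" .
  show ?thesis
    using ms sub sets.sigma_algebra_axioms[of "borel :: 'a measure"]
    by (auto simp: measure_space_def positive_def countably_additive_def)
qed

lemma emeasure_traj_measure:
  "E \<in> sets borel \<Longrightarrow> emeasure (traj_measure \<Gamma>) E = hausdorff1 (E \<inter> \<Gamma>)"
  using measure_space_hausdorff1[of \<Gamma>] unfolding traj_measure_def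
  by (intro emeasure_measure_of_sigma) (auto simp: measure_space_def)

text \<open>The domain carries Lebesgue measurability, so Borel measurable curves are included.\<close>

definition trajectory :: "'a::euclidean_space set \<Rightarrow> bool" where
  "trajectory \<Gamma> \<longleftrightarrow> (\<exists>\<gamma> :: real \<Rightarrow> 'a. \<gamma> \<in> measurable lebesgue borel \<and> \<Gamma> = range \<gamma>)"

definition regular_set :: "'a::euclidean_space set \<Rightarrow> bool" where
  "regular_set \<Gamma> \<longleftrightarrow>
     (\<exists>r0>0. (SUP x. emeasure (traj_measure \<Gamma>) (ball x r0)) < \<infinity> \<and>
       (\<forall>r. 0 < r \<and> r \<le> r0 \<longrightarrow>
          (\<exists>c::real. c > 0 \<and> (INF x\<in>\<Gamma>. emeasure (traj_measure \<Gamma>) (ball x r)) \<ge> ennreal c)))"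

definition fourier_transform :: "('a::euclidean_space \<Rightarrow> complex) \<Rightarrow> 'a \<Rightarrow> complex" where
  "fourier_transform F x = (LINT \<xi>|lebesgue. cis (- 2 * pi * (x \<bullet> \<xi>)) * F \<xi>)"

text \<open>The definition below is intended for bounded \<open>\<Omega>\<close>: then every square-integrable \<open>F\<close> vanishing
  outside \<open>\<Omega>\<close> is integrable, so that its \<open>L\<^sup>2\<close> Fourier transform is given by the integral, which
  moreover is the continuous representative.\<close>

definition PW2 :: "'a::euclidean_space set \<Rightarrow> ('a \<Rightarrow> complex) set" where
  "PW2 \<Omega> = fourier_transform `
     {F. F \<in> borel_measurable lebesgue \<and> integrable lebesgue (\<lambda>\<xi>. (cmod (F \<xi>))\<^sup>2) \<and>
         (AE \<xi> in lebesgue. \<xi> \<notin> \<Omega> \<longrightarrow> F \<xi> = 0)}"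

definition L2_norm_sq :: "('a::euclidean_space \<Rightarrow> complex) \<Rightarrow> ennreal" where
  "L2_norm_sq f = (\<integral>\<^sup>+x. ennreal ((cmod (f x))\<^sup>2) \<partial>lebesgue)"

definition sampling_trajectory :: "'a::euclidean_space set \<Rightarrow> 'a set \<Rightarrow> bool" where
  "sampling_trajectory \<Omega> \<Gamma> \<longleftrightarrow>
     (\<exists>A B :: real. A > 0 \<and> B > 0 \<and>
       (\<forall>f\<in>PW2 \<Omega>.
          ennreal A * L2_norm_sq f \<le> (\<integral>\<^sup>+x. ennreal ((cmod (f x))\<^sup>2) \<partial>traj_measure \<Gamma>) \<and>
          (\<integral>\<^sup>+x. ennreal ((cmod (f x))\<^sup>2) \<partial>traj_measure \<Gamma>) \<le> ennreal B * L2_norm_sq f))"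

definition sampling_set :: "'a::euclidean_space set \<Rightarrow> 'a set \<Rightarrow> bool" where
  "sampling_set \<Omega> \<Lambda> \<longleftrightarrow>
     (\<exists>A B :: real. A > 0 \<and> B > 0 \<and>
       (\<forall>f\<in>PW2 \<Omega>.
          ennreal A * L2_norm_sq f \<le> (\<integral>\<^sup>+l. ennreal ((cmod (f l))\<^sup>2) \<partial>count_space \<Lambda>) \<and>
          (\<integral>\<^sup>+l. ennreal ((cmod (f l))\<^sup>2) \<partial>count_space \<Lambda>) \<le> ennreal B * L2_norm_sq f))"

end

theory Submission
  imports Defs "HOL-Probability.Sinc_Integral"
begin

text \<open>Let \<open>\<phi>\<close> be a product of one-dimensional de la Vallee Poussin kernels whose Fourier transform is
  \<open>1\<close> on a ball containing \<open>\<Omega>\<close>, so that \<open>f = f * \<phi>\<close> for \<open>f\<close> in the Paley-Wiener space. By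
  Cauchy-Schwarz, \<open>|f(x)|\<^sup>2\<close> and \<open>|f(y) - f(x)|\<^sup>2 / |x - y|\<^sup>2\<close> are both bounded by a constant times the
  average \<open>g(x)\<close> of \<open>|f|\<^sup>2\<close> against the integrable weight \<open>w(x - z) = (\<Prod>b. 1 / (1 + ((x - z) \<bullet> b)\<^sup>2))\<close>.
  For a measure \<open>\<nu>\<close> that is uniformly bounded on balls of a fixed radius, \<open>\<integral> g d\<nu> \<le> K \<parallel>f\<parallel>\<^sup>2\<close>.
  Hence \<open>\<nu>\<close> satisfies the upper sampling inequality, and replacing \<open>f(x)\<close> by \<open>f(y)\<close> with \<open>|x - y| < r\<close>
  costs only \<open>O(r\<^sup>2) \<parallel>f\<parallel>\<^sup>2\<close> after integration over \<open>x\<close>, which the lower inequality for \<open>\<nu>\<close> absorbs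
  when \<open>r\<close> is small, because \<open>\<parallel>f\<parallel>\<close> is finite. This transfers sampling between \<open>\<Gamma>\<close> and a
  maximal \<open>r\<close>-separated subset of it, and from a subset \<open>\<Lambda>\<close> back to \<open>\<Gamma>\<close>.\<close>

section \<open>Fejer and de la Vallee Poussin kernels on the line\<close>

text \<open>The order of quantifiers shapes the transfer: the admissible radius is fixed by \<Omega>
  and the measure that already samples, before the target measure and its lower mass bound c are
  known. As c multiplies the absorbed error as well as the main term, the bounds c_r of a regular
  trajectory may degenerate arbitrarily as r tends to 0. A sampling set \<Lambda> is not assumed to
  be separated, so its local boundedness has to be extracted from its upper inequality, by testing
  with translates of one fixed function; here the positive measure of \<Omega> enters. Absorption
  subtracts a multiple of the squared norm and is void if that norm is infinite; since the space is
  defined by an integral transform, finiteness is a statement of its own, half of Plancherel's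
  theorem. The weight is built from 1 / (1 + t^2) because it must be integrable, must dominate the
  kernel and its increments, and may change only by a bounded factor under shifts of length at most
  1. Coordinatewise products reduce all explicit Fourier integrals to one dimension.\<close>

lemma integrable_inverse_one_plus_square: "integrable lborel (\<lambda>t::real. 1 / (1 + t\<^sup>2))"
  using integrable_inverse_1_plus_square
  by (simp add: set_integrable_def einterval_def inverse_eq_divide)

lemma one_minus_cos_le: "1 - cos (x::real) \<le> x\<^sup>2 / 2"
proof -
  have "1 - cos x = 2 * (sin (x / 2))\<^sup>2"
    using cos_double_sin[of "x / 2"] by simp
  moreover have "(sin (x / 2))\<^sup>2 \<le> (x / 2)\<^sup>2"
    using abs_sin_x_le_abs_x[of "x / 2"] by (intro abs_le_square_iff[THEN iffD1])
  ultimately show ?thesis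
    by (simp add: power_divide)
qed

lemma cos_quotient_nonneg: "0 \<le> (1 - cos (c * t)) / (t::real)\<^sup>2"
  by simp

text \<open>Two regimes in one constant: c^2 / 2 comes from 1 - cos x <= x^2 / 2 near 0, and 2 from
  1 - cos x <= 2 far out. At t = 0 the quotient is 0 by the convention for division, not its limit
  c^2 / 2.\<close>

lemma cos_quotient_le: "(1 - cos (c * t)) / t\<^sup>2 \<le> (c\<^sup>2 / 2 + 2) * (1 / (1 + (t::real)\<^sup>2))"
proof (cases "t = 0")
  case False
  have p: "0 < 1 + t\<^sup>2" by (smt (verit) zero_le_power2)
  have "(1 - cos (c * t)) * (1 + t\<^sup>2) = (1 - cos (c * t)) + (1 - cos (c * t)) * t\<^sup>2"
    by (simp add: algebra_simps)
  also have "\<dots> \<le> (c * t)\<^sup>2 / 2 + 2 * t\<^sup>2"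
    using one_minus_cos_le[of "c * t"] cos_ge_minus_one[of "c * t"]
    by (intro add_mono mult_right_mono) auto
  also have "\<dots> = (c\<^sup>2 / 2 + 2) * t\<^sup>2"
    by (simp add: power_mult_distrib algebra_simps)
  finally show ?thesis
    using False p by (simp add: divide_simps) (simp add: algebra_simps)
qed simp

lemma integrable_cos_quotient: "integrable lborel (\<lambda>t::real. (1 - cos (c * t)) / t\<^sup>2)"
proof (rule Bochner_Integration.integrable_bound)
  show "integrable lborel (\<lambda>t::real. (c\<^sup>2 / 2 + 2) * (1 / (1 + t\<^sup>2)))"
    by (intro integrable_mult_right integrable_inverse_one_plus_square)
  show "AE t in lborel. norm ((1 - cos (c * t)) / t\<^sup>2) \<le> norm ((c\<^sup>2 / 2 + 2) * (1 / (1 + t\<^sup>2)))"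
  proof (rule AE_I2)
    fix t :: real
    show "norm ((1 - cos (c * t)) / t\<^sup>2) \<le> norm ((c\<^sup>2 / 2 + 2) * (1 / (1 + t\<^sup>2)))"
      using cos_quotient_le[of c t] cos_quotient_nonneg[of c t] unfolding real_norm_def by linarith
  qed
qed measurable

text \<open>This number is pi, the mass of the unnormalised Fejer kernel.\<close>

definition fejer_const :: real where
  "fejer_const = (LINT t::real|lborel. (1 - cos t) / t\<^sup>2)"

text \<open>Substitution of c * t for t. The dependence through |c| is the point: combinations of
  shifted absolute values are piecewise linear, and give the tent and the trapezoid below.\<close>

lemma integral_cos_quotient: "(LINT t|lborel. (1 - cos (c * t)) / t\<^sup>2) = fejer_const * \<bar>c\<bar>"
proof (cases "c = 0")
  case False
  have "fejer_const = \<bar>c\<bar> *\<^sub>R (LINT t|lborel. (1 - cos (0 + c * t)) / (0 + c * t)\<^sup>2)"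
    unfolding fejer_const_def by (rule lborel_integral_real_affine[OF False])
  also have "(\<lambda>t. (1 - cos (0 + c * t)) / (0 + c * t)\<^sup>2) = (\<lambda>t. (1 / c\<^sup>2) * ((1 - cos (c * t)) / t\<^sup>2))"
    by (auto simp: power_mult_distrib)
  also have "integral\<^sup>L lborel \<dots> = (1 / c\<^sup>2) * (LINT t|lborel. (1 - cos (c * t)) / t\<^sup>2)"
    by (rule integral_mult_right_zero)
  finally have eq: "fejer_const = \<bar>c\<bar> * (1 / c\<^sup>2 * (LINT t|lborel. (1 - cos (c * t)) / t\<^sup>2))"
    by (simp only: real_scaleR_def)
  have "a * (1 / q * x) * a = a * a / q * x" for a q x :: real
    by simp
  then have "fejer_const * \<bar>c\<bar> = \<bar>c\<bar> * \<bar>c\<bar> / c\<^sup>2 * (LINT t|lborel. (1 - cos (c * t)) / t\<^sup>2)"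
    unfolding eq .
  then show ?thesis
    using False by (simp add: power2_eq_square)
qed simp

lemma fejer_const_pos: "fejer_const > 0"
proof -
  have int: "integrable lborel (\<lambda>t::real. (1 - cos t) / t\<^sup>2)"
    using integrable_cos_quotient[of 1] by simp
  have "fejer_const \<noteq> 0"
  proof
    assume "fejer_const = 0"
    then have "AE t in lborel. (1 - cos t) / (t::real)\<^sup>2 = 0"
      unfolding fejer_const_def
      using integral_nonneg_eq_0_iff_AE[OF int] by simp
    then have "emeasure lborel {t::real. (1 - cos t) / t\<^sup>2 \<noteq> 0} = 0"
      by (subst (asm) AE_iff_measurable[OF _ refl]) auto
    moreover have "{1..2::real} \<subseteq> {t. (1 - cos t) / t\<^sup>2 \<noteq> 0}"
    proof
      fix t :: real assume t: "t \<in> {1..2}"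
      then have "cos t < cos 0"
        using pi_gt3 by (intro cos_monotone_0_pi) auto
      then show "t \<in> {t. (1 - cos t) / t\<^sup>2 \<noteq> 0}" using t by auto
    qed
    then have "emeasure lborel {1..2::real} \<le> emeasure lborel {t::real. (1 - cos t) / t\<^sup>2 \<noteq> 0}"
      by (intro emeasure_mono) auto
    ultimately show False by simp
  qed
  moreover have "fejer_const \<ge> 0"
    unfolding fejer_const_def by (rule Bochner_Integration.integral_nonneg) simp
  ultimately show ?thesis by simp
qed

text \<open>Both kernels below reduce to the previous integral by writing a product of two cosines as a
  sum; no closed form of the constant is needed.\<close>

lemma has_integral_cos_quotient_cos:
  "has_bochner_integral lborel (\<lambda>t::real. (1 - cos (c * t)) / t\<^sup>2 * cos (s * t))
     (fejer_const * ((\<bar>c + s\<bar> + \<bar>c - s\<bar>) / 2 - \<bar>s\<bar>))"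
proof -
  have h: "has_bochner_integral lborel (\<lambda>t::real. (1 - cos (c * t)) / t\<^sup>2) (fejer_const * \<bar>c\<bar>)" for c
    using integrable_cos_quotient[of c] integral_cos_quotient[of c] by (simp add: has_bochner_integral_iff)
  have "has_bochner_integral lborel
     (\<lambda>t. ((1 - cos ((c + s) * t)) / t\<^sup>2 + (1 - cos ((c - s) * t)) / t\<^sup>2) / 2 - (1 - cos (s * t)) / t\<^sup>2)
     ((fejer_const * \<bar>c + s\<bar> + fejer_const * \<bar>c - s\<bar>) / 2 - fejer_const * \<bar>s\<bar>)"
    by (intro has_bochner_integral_diff has_bochner_integral_divide has_bochner_integral_add h)
  moreover have "((1 - cos ((c + s) * t)) / t\<^sup>2 + (1 - cos ((c - s) * t)) / t\<^sup>2) / 2 - (1 - cos (s * t)) / t\<^sup>2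
      = (1 - cos (c * t)) / t\<^sup>2 * cos (s * t)" for t
  proof -
    have "(1 - cos (c * t)) * cos (s * t) = ((1 - cos ((c + s) * t)) + (1 - cos ((c - s) * t))) / 2 - (1 - cos (s * t))"
      by (simp add: cos_add cos_diff field_simps)
    moreover have "(a / q + b / q) / 2 - d / q = ((a + b) / 2 - d) / q" for a b d q :: real
      by (simp add: add_divide_distrib diff_divide_distrib)
    ultimately show ?thesis by (metis times_divide_eq_left)
  qed
  ultimately show ?thesis by (simp add: algebra_simps add_divide_distrib)
qed

text \<open>The sine part is odd, so reflection equates its integral with its own negative; only the
  cosine part remains.\<close>

lemma has_integral_even_cis:
  fixes h :: "real \<Rightarrow> real"
  assumes h: "integrable lborel h" and even: "\<And>t. h (- t) = h t"
    and I: "has_bochner_integral lborel (\<lambda>t. h t * cos (s * t)) I"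
  shows "has_bochner_integral lborel (\<lambda>t. of_real (h t) * cis (s * t)) (of_real I)"
proof -
  have [measurable]: "h \<in> borel_measurable lborel" using h by auto
  have int: "integrable lborel (\<lambda>t. h t * sin (s * t))"
    by (rule Bochner_Integration.integrable_bound[OF h]) (auto simp: abs_mult intro!: mult_left_le)
  have "(LINT t|lborel. h t * sin (s * t)) = \<bar>-1\<bar> *\<^sub>R (LINT t|lborel. h (0 + -1 * t) * sin (s * (0 + -1 * t)))"
    by (rule lborel_integral_real_affine) simp
  also have "\<dots> = - (LINT t|lborel. h t * sin (s * t))"
    by (simp add: even)
  finally have "(LINT t|lborel. h t * sin (s * t)) = 0" by simp
  then have S: "has_bochner_integral lborel (\<lambda>t. h t * sin (s * t)) 0"
    using int by (simp add: has_bochner_integral_iff)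
  have "has_bochner_integral lborel
      (\<lambda>t. of_real (h t * cos (s * t)) + \<i> * of_real (h t * sin (s * t))) (of_real I + \<i> * of_real 0)"
    by (intro has_bochner_integral_add has_bochner_integral_mult_right has_bochner_integral_of_real I S)
  moreover have "of_real (h t * cos (s * t)) + \<i> * of_real (h t * sin (s * t)) = of_real (h t) * cis (s * t)" for t
    by (simp add: complex_eq_iff)
  ultimately show ?thesis by simp
qed

text \<open>Equal to (sin (c t / 2) / (c t / 2))^2 for nonzero c and t. The normalisation is by the
  peak, not by the mass, since the kernel serves as a weight that flattens to 1 as c tends to 0. The
  value at 0 is set by hand, where the quotient would give 0; convergence to 1 then holds at every
  point.\<close>

definition fejer :: "real \<Rightarrow> real \<Rightarrow> real" where
  "fejer c t = (if t = 0 then 1 else (1 - cos (c * t)) / t\<^sup>2 * (2 / c\<^sup>2))"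

lemma fejer_nonneg: "0 \<le> fejer c t"
  by (simp add: fejer_def)

lemma borel_measurable_fejer [measurable]: "fejer c \<in> borel_measurable borel"
  unfolding fejer_def[abs_def] by measurable

lemma AE_fejer: "AE t in lborel. (1 - cos (c * t)) / t\<^sup>2 * (2 / c\<^sup>2) = fejer c t"
  using AE_lborel_singleton[of 0] by eventually_elim (simp add: fejer_def)

lemma integrable_fejer: "integrable lborel (fejer c)"
  by (rule integrable_cong_AE_imp[OF integrable_mult_left[OF integrable_cos_quotient] _ AE_fejer]) simp

text \<open>The transform is a multiple of the tent max (c - |s|) 0. Replacing the tent by its
  height on its support leaves a box of height of order 1 / c and length 2 c, whose area does not
  depend on c.\<close>

lemma norm_integral_fejer_cis:
  assumes c: "c > 0"
  shows "norm (LINT t|lborel. of_real (fejer c t) * cis (s * t)) \<le> 2 * fejer_const / c * indicator {-c..c} s"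
proof -
  have "has_bochner_integral lborel (\<lambda>t. (1 - cos (c * t)) / t\<^sup>2 * cos (s * t) * (2 / c\<^sup>2))
     (fejer_const * ((\<bar>c + s\<bar> + \<bar>c - s\<bar>) / 2 - \<bar>s\<bar>) * (2 / c\<^sup>2))"
    by (intro has_bochner_integral_mult_left has_integral_cos_quotient_cos)
  then have "has_bochner_integral lborel (\<lambda>t. fejer c t * cos (s * t))
     (fejer_const * ((\<bar>c + s\<bar> + \<bar>c - s\<bar>) / 2 - \<bar>s\<bar>) * (2 / c\<^sup>2))"
  proof (rule has_bochner_integral_cong_AE[THEN iffD1, rotated 3])
    show "AE t in lborel. (1 - cos (c * t)) / t\<^sup>2 * cos (s * t) * (2 / c\<^sup>2) = fejer c t * cos (s * t)"
      using AE_fejer[of c] by eventually_elim (simp only: mult_ac)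
  qed measurable
  from has_integral_even_cis[OF integrable_fejer _ this]
  have "(LINT t|lborel. of_real (fejer c t) * cis (s * t))
      = complex_of_real (fejer_const * ((\<bar>c + s\<bar> + \<bar>c - s\<bar>) / 2 - \<bar>s\<bar>) * (2 / c\<^sup>2))"
    by (simp add: fejer_def has_bochner_integral_iff)
  then have "norm (LINT t|lborel. of_real (fejer c t) * cis (s * t))
      = fejer_const * \<bar>(\<bar>c + s\<bar> + \<bar>c - s\<bar>) / 2 - \<bar>s\<bar>\<bar> * (2 / c\<^sup>2)"
    using fejer_const_pos by (simp only: norm_of_real) (simp add: abs_mult)
  also have "\<dots> \<le> fejer_const * (c * indicator {-c..c} s) * (2 / c\<^sup>2)"
    using fejer_const_pos c by (intro mult_right_mono mult_left_mono) (auto split: split_indicator)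
  also have "\<dots> = 2 * fejer_const / c * indicator {-c..c} s"
    using c by (simp add: power2_eq_square)
  finally show ?thesis .
qed

lemma fejer_tendsto_1: "(\<lambda>n. fejer (1 / real (Suc n)) t) \<longlonglongrightarrow> 1"
proof (cases "t = 0")
  case True
  then show ?thesis by (simp add: fejer_def)
next
  case False
  have "((\<lambda>c. (sin (c * t / 2) / (c * t / 2))\<^sup>2) \<longlongrightarrow> 1\<^sup>2) (at 0)"
  proof (rule tendsto_power)
    have "filterlim (\<lambda>c. c * t / 2) (at 0) (at 0)"
      using False by (auto simp: filterlim_at eventually_at_filter intro!: tendsto_eq_intros)
    then show "((\<lambda>c. sin (c * t / 2) / (c * t / 2)) \<longlongrightarrow> 1) (at 0)"
      by (rule filterlim_compose[OF sinc_at_0])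
  qed
  moreover have "fejer c t = (sin (c * t / 2) / (c * t / 2))\<^sup>2" for c
    using False cos_double_sin[of "c * t / 2"] by (simp add: fejer_def power_divide power_mult_distrib mult.commute)
  ultimately have "((\<lambda>c. fejer c t) \<longlongrightarrow> 1) (at 0)" by simp
  moreover have "filterlim (\<lambda>n. 1 / real (Suc n)) (at 0) sequentially"
    using LIMSEQ_inverse_real_of_nat by (auto simp: filterlim_at inverse_eq_divide)
  ultimately show ?thesis by (rule filterlim_compose)
qed

section \<open>Decay and Lipschitz bounds for \<open>sinc\<close>\<close>

lemma integral_cos_0_1: "((\<lambda>u. cos (x * u)) has_integral sinc x) {0..1::real}"
proof -
  let ?F = "\<lambda>u::real. if x = 0 then u else sin (x * u) / x"
  have "((\<lambda>u. cos (x * u)) has_integral ?F 1 - ?F 0) {0..1}"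
  proof (rule fundamental_theorem_of_calculus)
    fix u :: real
    show "(?F has_vector_derivative cos (x * u)) (at u within {0..1})"
      by (cases "x = 0")
         (auto intro!: derivative_eq_intros simp: has_real_derivative_iff_has_vector_derivative[symmetric])
  qed simp
  then show ?thesis by (cases "x = 0") auto
qed

text \<open>\<open>sinc x\<close> is the average of cos (x u) over u in [0, 1], and each of these
  cosines is 1-Lipschitz in x. This treats the removable singularity without a case
  distinction.\<close>

lemma sinc_Lipschitz: "\<bar>sinc x - sinc y\<bar> \<le> \<bar>x - y\<bar>"
proof -
  have "((\<lambda>u. cos (x * u) - cos (y * u)) has_integral sinc x - sinc y) (cbox 0 1)"
    unfolding cbox_interval by (intro has_integral_diff integral_cos_0_1)
  then have "norm (sinc x - sinc y) \<le> \<bar>x - y\<bar> * measure lborel (cbox 0 (1::real))"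
  proof (rule has_integral_bound[rotated])
    fix u :: real assume "u \<in> cbox 0 1"
    then have u: "0 \<le> u" "u \<le> 1" by auto
    have "\<bar>cos (x * u) - cos (y * u)\<bar> = 2 * \<bar>sin ((x * u + y * u) / 2)\<bar> * \<bar>sin ((y * u - x * u) / 2)\<bar>"
      by (simp add: cos_diff_cos abs_mult)
    also have "\<dots> \<le> 2 * 1 * \<bar>(y * u - x * u) / 2\<bar>"
      by (intro mult_mono abs_sin_x_le_abs_x) auto
    also have "\<dots> = \<bar>x - y\<bar> * u"
      using u by (simp add: left_diff_distrib[symmetric] abs_mult abs_minus_commute)
    also have "\<dots> \<le> \<bar>x - y\<bar>" using u by (intro mult_left_le) auto
    finally show "norm (cos (x * u) - cos (y * u)) \<le> \<bar>x - y\<bar>" by simp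
  qed auto
  then show ?thesis by (simp add: real_norm_def del: sinc_neg)
qed

lemma abs_sinc_le: "\<bar>sinc x\<bar> \<le> 2 / (1 + \<bar>x\<bar>)"
proof (cases "\<bar>x\<bar> \<le> 1")
  case True
  have "\<bar>sinc x\<bar> \<le> 1"
    using abs_sin_x_le_abs_x[of x] by (auto simp: divide_simps)
  also have "1 \<le> 2 / (1 + \<bar>x\<bar>)" using True by (simp add: field_simps)
  finally show ?thesis .
next
  case False
  then have "\<bar>sinc x\<bar> \<le> 1 / \<bar>x\<bar>"
    using abs_sin_le_one[of x] by (auto simp: divide_simps)
  also have "\<dots> \<le> 2 / (1 + \<bar>x\<bar>)" using False by (simp add: field_simps)
  finally show ?thesis .
qed

text \<open>For |x| <= 1 the Lipschitz bound suffices. For larger |x| the gain 1 / |x| comes from x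
  (sinc y - sinc x) = (sin y - sin x) + sin y (x - y) / y, valid for nonzero y, where both summands
  are at most |y - x| in modulus.\<close>

lemma abs_sinc_diff_le: "\<bar>sinc y - sinc x\<bar> \<le> 4 * \<bar>y - x\<bar> / (1 + \<bar>x\<bar>)"
proof (cases "\<bar>x\<bar> \<le> 1")
  case True
  have "\<bar>sinc y - sinc x\<bar> \<le> \<bar>y - x\<bar> * 1" using sinc_Lipschitz[of y x] by simp
  also have "\<dots> \<le> \<bar>y - x\<bar> * (4 / (1 + \<bar>x\<bar>))"
    using True by (intro mult_left_mono) (auto simp: field_simps)
  finally show ?thesis by (simp add: mult.commute)
next
  case False
  have "\<bar>sinc y - sinc x\<bar> \<le> 2 * \<bar>y - x\<bar> / \<bar>x\<bar>"
  proof (cases "y = 0")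
    case True
    have "\<bar>sinc x\<bar> \<le> 1"
      using abs_sin_x_le_abs_x[of x] by (auto simp: divide_simps)
    then show ?thesis using True False by auto
  next
    case y: False
    have x: "x \<noteq> 0" using False by auto
    have "\<bar>sin y - sin x\<bar> \<le> \<bar>y - x\<bar>"
    proof -
      have "\<bar>sin y - sin x\<bar> = 2 * \<bar>sin ((y - x) / 2)\<bar> * \<bar>cos ((y + x) / 2)\<bar>"
        by (simp add: sin_diff_sin abs_mult)
      also have "\<dots> \<le> 2 * \<bar>(y - x) / 2\<bar> * 1"
        by (intro mult_mono abs_sin_x_le_abs_x) auto
      finally show ?thesis by simp
    qed
    moreover have "\<bar>sin y * (x - y) / y\<bar> \<le> \<bar>y - x\<bar>"
      using mult_right_mono[OF abs_sin_x_le_abs_x[of y], of "\<bar>x - y\<bar>"] y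
      by (simp add: abs_mult divide_simps abs_minus_commute mult.commute)
    ultimately have "\<bar>(sin y - sin x) + sin y * (x - y) / y\<bar> \<le> 2 * \<bar>y - x\<bar>"
      using abs_triangle_ineq[of "sin y - sin x" "sin y * (x - y) / y"] by simp
    moreover have "sinc y - sinc x = ((sin y - sin x) + sin y * (x - y) / y) / x"
      using x y by (simp add: field_simps)
    ultimately show ?thesis
      by (simp only: abs_divide) (intro divide_right_mono, auto)
  qed
  also have "\<dots> \<le> 4 * \<bar>y - x\<bar> / (1 + \<bar>x\<bar>)"
  proof -
    have "2 / \<bar>x\<bar> \<le> 4 / (1 + \<bar>x\<bar>)" using False by (simp add: field_simps)
    from mult_right_mono[OF this, of "\<bar>y - x\<bar>"] show ?thesis by simp
  qed
  finally show ?thesis .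
qed

text \<open>This profile is integrable and matches the decay of a product of two \<open>sinc\<close>
  factors.\<close>

definition decay :: "real \<Rightarrow> real" where
  "decay t = 1 / (1 + t\<^sup>2)"

lemma decay_pos: "decay t > 0"
  unfolding decay_def by (smt (verit) divide_pos_pos zero_le_power2)

lemma borel_measurable_decay [measurable]: "decay \<in> borel_measurable borel"
  unfolding decay_def[abs_def] by measurable

lemma decay_le_1: "decay t \<le> 1"
  unfolding decay_def by (smt (verit) divide_le_eq_1 zero_le_power2)

text \<open>From t^2 <= 2 (t + s)^2 + 2 s^2 and s^2 <= 1; the factor 3 is 1 + 2.\<close>

lemma decay_shift_le:
  assumes "\<bar>s\<bar> \<le> 1"
  shows "decay (t + s) \<le> 3 * decay t"
proof -
  have p: "0 < 1 + t\<^sup>2" "0 < 1 + (t + s)\<^sup>2" by (smt (verit) zero_le_power2)+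
  have "s\<^sup>2 \<le> 1" using assms by (simp add: abs_square_le_1)
  moreover have "t\<^sup>2 \<le> 2 * (t + s)\<^sup>2 + 2 * s\<^sup>2"
    using zero_le_power2[of "t + 2 * s"] by (simp add: power2_eq_square algebra_simps)
  moreover have "1 + a \<le> 3 * (1 + c)" if "b \<le> 1" "a \<le> 2 * c + 2 * b" "0 \<le> c" for a b c :: real
    using that by simp
  ultimately have "1 + t\<^sup>2 \<le> 3 * (1 + (t + s)\<^sup>2)"
    using zero_le_power2[of "t + s"] by blast
  then show ?thesis
    using p by (simp add: decay_def divide_simps)
qed

text \<open>The Fourier transform of this de la Vallee Poussin kernel is a trapezoid, equal to \<open>1\<close> for
  frequencies up to \<open>A\<close>.\<close>

definition vp_kernel :: "real \<Rightarrow> real \<Rightarrow> real" where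
  "vp_kernel A t = 2 * A / fejer_const * (sinc (2 * A * t) * sinc (A * t))"

lemma borel_measurable_vp_kernel [measurable]: "vp_kernel A \<in> borel_measurable borel"
  unfolding vp_kernel_def[abs_def] by measurable

text \<open>Each \<open>sinc\<close> factor is O(1 / (1 + |t|)), and so is its increment divided by
  |s|. Two such factors multiply to \<open>decay\<close>, and the increment of the product is
  telescoped into increments of single factors.\<close>

lemma vp_kernel_bounds:
  assumes A: "A > 0"
  obtains D where "D > 0" "\<And>t. \<bar>vp_kernel A t\<bar> \<le> D * decay t"
    "\<And>s t. \<bar>s\<bar> \<le> 1 \<Longrightarrow> \<bar>vp_kernel A (t + s) - vp_kernel A t\<bar> \<le> D * \<bar>s\<bar> * decay t"
proof -
  \<comment> \<open>\<open>m\<close> is at most 1 and at most both frequencies \<open>A\<close> and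
    \<open>2 * A\<close>, so one constant turns 1 + |a t| into 1 + |t| for both factors.\<close>
  define m where "m = min 1 A"
  have m: "0 < m" "m \<le> 1" "m \<le> A" using A by (auto simp: m_def)
  have scale: "1 / (1 + \<bar>a * t\<bar>) \<le> (1 / m) * (1 / (1 + \<bar>t\<bar>))" if "m \<le> a" for a t
  proof -
    have "m * (1 + \<bar>t\<bar>) = m + m * \<bar>t\<bar>" by (simp add: algebra_simps)
    also have "\<dots> \<le> 1 + a * \<bar>t\<bar>" using m that by (intro add_mono mult_right_mono) auto
    also have "\<dots> = 1 + \<bar>a * t\<bar>" using m that by (simp add: abs_mult)
    finally show ?thesis using m by (simp add: divide_simps)
  qed
  define q where "q t = 1 / (1 + \<bar>t\<bar>)" for t :: real
  have q: "q t > 0" "q t * q t \<le> decay t" for t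
  proof -
    show "q t > 0" by (simp add: q_def add_pos_nonneg)
    have "1 + t\<^sup>2 \<le> (1 + \<bar>t\<bar>) * (1 + \<bar>t\<bar>)" by (simp add: algebra_simps power2_eq_square)
    moreover have "0 < 1 + t\<^sup>2" by (smt (verit) zero_le_power2)
    ultimately show "q t * q t \<le> decay t"
      unfolding q_def decay_def by (simp add: divide_simps)
  qed
  have b: "\<bar>sinc (a * t)\<bar> \<le> 2 / m * q t" if "m \<le> a" for a t
    using order_trans[OF abs_sinc_le mult_left_mono[OF scale[OF that, of t], of 2, simplified]]
    by (simp add: q_def)
  have d: "\<bar>sinc (a * (t + s)) - sinc (a * t)\<bar> \<le> 8 * A / m * (\<bar>s\<bar> * q t)" if "m \<le> a" "a \<le> 2 * A" for a s t
  proof -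
    have "\<bar>sinc (a * (t + s)) - sinc (a * t)\<bar> \<le> 4 * \<bar>a * s\<bar> * (1 / (1 + \<bar>a * t\<bar>))"
      using abs_sinc_diff_le[of "a * (t + s)" "a * t"] by (simp add: algebra_simps)
    also have "\<dots> \<le> (8 * A * \<bar>s\<bar>) * ((1 / m) * (1 / (1 + \<bar>t\<bar>)))"
    proof (rule mult_mono[OF _ scale[OF that(1)]])
      have "a * \<bar>s\<bar> \<le> 2 * A * \<bar>s\<bar>" using that by (intro mult_right_mono) auto
      then show "4 * \<bar>a * s\<bar> \<le> 8 * A * \<bar>s\<bar>" using that m by (simp add: abs_mult)
    qed (use A in auto)
    finally show ?thesis by (simp add: q_def)
  qed
  have qs: "q (t + s) \<le> 2 * q t" if "\<bar>s\<bar> \<le> 1" for s t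
  proof -
    have "1 / y \<le> 2 * (1 / x)" if "x \<le> 2 * y" "0 < x" "0 < y" for x y :: real
      using that by (simp add: field_simps)
    moreover have "1 + \<bar>t\<bar> \<le> 2 * (1 + \<bar>t + s\<bar>)"
      using that abs_triangle_ineq4[of "t + s" s] abs_ge_zero[of "t + s"] unfolding add_diff_cancel_right' by argo
    ultimately show ?thesis by (simp add: q_def add_pos_nonneg)
  qed
  define N where "N = 2 * A / fejer_const"
  have N: "N > 0" using A fejer_const_pos by (simp add: N_def)
  have nn: "0 \<le> q t" for t using q(1)[of t] by simp
  define D1 where "D1 = (2 / m) * (2 / m)"
  define D2 where "D2 = (8 * A / m) * (2 / m) * 2 + (2 / m) * (8 * A / m)"
  have D: "D1 > 0" "D2 > 0" using m A by (auto simp: D1_def D2_def intro!: add_pos_pos)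
  show thesis
  proof (rule that[of "N * (D1 + D2)"])
    show "N * (D1 + D2) > 0" using N D by simp
    fix t
    have "\<bar>vp_kernel A t\<bar> = N * (\<bar>sinc (2 * A * t)\<bar> * \<bar>sinc (A * t)\<bar>)"
      using N unfolding vp_kernel_def N_def[symmetric] by (simp only: abs_mult abs_of_pos)
    also have "\<dots> \<le> N * ((2 / m * q t) * (2 / m * q t))"
      using N m nn by (intro mult_left_mono mult_mono b) auto
    also have "\<dots> = N * (D1 * (q t * q t))" by (simp add: D1_def)
    also have "\<dots> \<le> N * ((D1 + D2) * decay t)"
      using N D q[of t] nn[of t] by (intro mult_left_mono mult_mono) auto
    finally show "\<bar>vp_kernel A t\<bar> \<le> N * (D1 + D2) * decay t" by simp
    fix s :: real assume s: "\<bar>s\<bar> \<le> 1"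
    let ?a = "sinc (2 * A * t)" and ?a' = "sinc (2 * A * (t + s))"
      and ?b = "sinc (A * t)" and ?b' = "sinc (A * (t + s))"
    \<comment> \<open>In this telescoping \<open>?b'\<close> sits at the shifted point; moving it
      back by \<open>qs\<close> is the origin of the extra factor 2 in \<open>D2\<close>.\<close>
    have "vp_kernel A (t + s) - vp_kernel A t = N * ((?a' - ?a) * ?b' + ?a * (?b' - ?b))"
      unfolding vp_kernel_def N_def[symmetric] by (simp only: algebra_simps)
    then have "\<bar>vp_kernel A (t + s) - vp_kernel A t\<bar> = N * \<bar>(?a' - ?a) * ?b' + ?a * (?b' - ?b)\<bar>"
      using N by (simp only: abs_mult abs_of_pos)
    also have "\<dots> \<le> N * (\<bar>?a' - ?a\<bar> * \<bar>?b'\<bar> + \<bar>?a\<bar> * \<bar>?b' - ?b\<bar>)"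
      using N by (intro mult_left_mono order_trans[OF abs_triangle_ineq]) (simp_all only: abs_mult order_refl)
    also have "\<dots> \<le> N * ((8 * A / m * (\<bar>s\<bar> * q t)) * (2 / m * (2 * q t)) + (2 / m * q t) * (8 * A / m * (\<bar>s\<bar> * q t)))"
      using N m A nn s
      by (intro mult_left_mono add_mono mult_mono d b order_trans[OF b[of A "t + s"] mult_left_mono[OF qs]]) auto
    also have "\<dots> = N * (D2 * \<bar>s\<bar>) * (q t * q t)" by (simp add: D2_def algebra_simps)
    also have "\<dots> \<le> N * ((D1 + D2) * \<bar>s\<bar>) * decay t"
      using N D q[of t] nn[of t] by (intro mult_left_mono mult_mono mult_right_mono) auto
    finally show "\<bar>vp_kernel A (t + s) - vp_kernel A t\<bar> \<le> N * (D1 + D2) * \<bar>s\<bar> * decay t" by simp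
  qed
qed

lemma integrable_decay: "integrable lborel decay"
  using integrable_inverse_one_plus_square by (simp add: decay_def[abs_def])

lemma integrable_vp_kernel:
  assumes "A > 0" shows "integrable lborel (vp_kernel A)"
proof -
  obtain D where "D > 0" "\<And>t. \<bar>vp_kernel A t\<bar> \<le> D * decay t"
    using vp_kernel_bounds[OF assms] by metis
  then show ?thesis
    by (intro Bochner_Integration.integrable_bound[OF integrable_mult_right[OF integrable_decay, of D]])
       (auto simp: abs_mult abs_of_pos[OF decay_pos])
qed

text \<open>As 2 sin (2 A t) sin (A t) = cos (A t) - cos (3 A t), the kernel is a normalised
  difference of the cosine quotients with parameters 3 A and A. For |s| <= A their tents have the
  values 3 A - |s| and A - |s|, so the difference is the constant 2 A.\<close>

lemma has_integral_vp_kernel_cis: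
  assumes A: "A > 0" and s: "\<bar>s\<bar> \<le> A"
  shows "has_bochner_integral lborel (\<lambda>t. of_real (vp_kernel A t) * cis (s * t)) 1"
proof -
  have "has_bochner_integral lborel (\<lambda>t. ((1 - cos (3 * A * t)) / t\<^sup>2 * cos (s * t)
        - (1 - cos (A * t)) / t\<^sup>2 * cos (s * t)) * (1 / (2 * A * fejer_const)))
     ((fejer_const * ((\<bar>3 * A + s\<bar> + \<bar>3 * A - s\<bar>) / 2 - \<bar>s\<bar>)
        - fejer_const * ((\<bar>A + s\<bar> + \<bar>A - s\<bar>) / 2 - \<bar>s\<bar>)) * (1 / (2 * A * fejer_const)))"
    by (intro has_bochner_integral_mult_left has_bochner_integral_diff has_integral_cos_quotient_cos)
  also have "(fejer_const * ((\<bar>3 * A + s\<bar> + \<bar>3 * A - s\<bar>) / 2 - \<bar>s\<bar>)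
        - fejer_const * ((\<bar>A + s\<bar> + \<bar>A - s\<bar>) / 2 - \<bar>s\<bar>)) * (1 / (2 * A * fejer_const)) = 1"
  proof -
    have "\<bar>3 * A + s\<bar> + \<bar>3 * A - s\<bar> = 6 * A" "\<bar>A + s\<bar> + \<bar>A - s\<bar> = 2 * A" using s A by auto
    then show ?thesis using A fejer_const_pos by (simp add: field_simps)
  qed
  finally have *: "has_bochner_integral lborel (\<lambda>t. ((1 - cos (3 * A * t)) / t\<^sup>2 * cos (s * t)
        - (1 - cos (A * t)) / t\<^sup>2 * cos (s * t)) * (1 / (2 * A * fejer_const))) 1" .
  have eq: "((1 - cos (3 * A * t)) / t\<^sup>2 * cos (s * t)
        - (1 - cos (A * t)) / t\<^sup>2 * cos (s * t)) * (1 / (2 * A * fejer_const)) = vp_kernel A t * cos (s * t)"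
    if t: "t \<noteq> 0" for t
  proof -
    have "cos (A * t) - cos (3 * A * t) = 2 * sin (2 * A * t) * sin (A * t)"
      by (simp add: cos_diff_cos) (simp add: algebra_simps)
    then have *: "((1 - cos (3 * A * t)) - (1 - cos (A * t))) / t\<^sup>2 * (1 / (2 * A * fejer_const)) = vp_kernel A t"
      using t A fejer_const_pos by (simp add: vp_kernel_def power2_eq_square field_simps)
    have "(u / q * d - v / q * d) * e = (u - v) / q * e * d" for u v q d e :: real
      by (simp add: diff_divide_distrib algebra_simps)
    then show ?thesis by (simp only: *)
  qed
  have "has_bochner_integral lborel (\<lambda>t. vp_kernel A t * cos (s * t)) 1"
  proof (rule has_bochner_integral_cong_AE[THEN iffD1, OF _ _ _ *])
    show "AE t in lborel. ((1 - cos (3 * A * t)) / t\<^sup>2 * cos (s * t)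
        - (1 - cos (A * t)) / t\<^sup>2 * cos (s * t)) * (1 / (2 * A * fejer_const)) = vp_kernel A t * cos (s * t)"
      using AE_lborel_singleton[of 0] by eventually_elim (rule eq)
  qed measurable
  moreover have "vp_kernel A (- t) = vp_kernel A t" for t
    by (simp add: vp_kernel_def)
  ultimately show ?thesis
    using has_integral_even_cis[OF integrable_vp_kernel[OF A]] by fastforce
qed

section \<open>Product kernels\<close>

lemma borel_measurable_cis [measurable]: "cis \<in> borel_measurable borel"
  by (intro borel_measurable_continuous_onI continuous_on_cis continuous_on_id)

lemma has_bochner_integral_prod_Basis:
  fixes f :: "'a::euclidean_space \<Rightarrow> real \<Rightarrow> 'b::{real_normed_field, banach, second_countable_topology}"
  assumes f: "\<And>b. b \<in> Basis \<Longrightarrow> has_bochner_integral lborel (f b) (I b)"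
  shows "has_bochner_integral lborel (\<lambda>u. \<Prod>b\<in>Basis. f b (u \<bullet> b)) (\<Prod>b\<in>Basis. I b)"
proof -
  interpret product_sigma_finite "\<lambda>_::'a. lborel :: real measure" ..
  have int: "integrable lborel (f b)" if "b \<in> Basis" for b
    using f[OF that] by (simp add: has_bochner_integral_iff)
  then have [measurable]: "f b \<in> borel_measurable borel" if "b \<in> Basis" for b
    using borel_measurable_integrable[OF int[OF that]] by simp
  have [measurable]: "(\<lambda>u. \<Prod>b\<in>Basis. f b (u \<bullet> b)) \<in> borel_measurable borel"
    by measurable
  have eq: "(\<Prod>b\<in>Basis. f b ((\<Sum>b\<in>Basis. x b *\<^sub>R b) \<bullet> b)) = (\<Prod>b\<in>Basis. f b (x b))" for x :: "'a \<Rightarrow> real"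
    by (intro prod.cong) auto
  have "has_bochner_integral (\<Pi>\<^sub>M b\<in>Basis. lborel) (\<lambda>x. \<Prod>b\<in>Basis. f b (x b)) (\<Prod>b\<in>Basis. I b)"
    unfolding has_bochner_integral_iff
    using product_integrable_prod[of Basis f] product_integral_prod[of Basis f] f int
    by (simp add: has_bochner_integral_iff)
  then show ?thesis
    by (subst lborel_eq) (rule has_bochner_integral_distr, auto simp: eq)
qed

section \<open>Reflection and translation in Lebesgue integrals\<close>

lemma distr_lborel_minus_left:
  fixes x :: "'a::euclidean_space"
  shows "distr lborel borel (\<lambda>z. x - z) = lborel"
  using lborel_affine[of "-1" x] by (simp add: density_1)

lemma nn_integral_minus_left:
  fixes x :: "'a::euclidean_space"
  assumes [measurable]: "h \<in> borel_measurable borel"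
  shows "(\<integral>\<^sup>+z. h (x - z) \<partial>lborel) = (\<integral>\<^sup>+z. h z \<partial>lborel)"
  by (subst (2) distr_lborel_minus_left[of x, symmetric]) (simp add: nn_integral_distr)

lemma nn_integral_plus_left:
  fixes x :: "'a::euclidean_space"
  assumes [measurable]: "h \<in> borel_measurable borel"
  shows "(\<integral>\<^sup>+z. h (x + z) \<partial>lborel) = (\<integral>\<^sup>+z. h z \<partial>lborel)"
  by (subst (2) lborel_distr_plus[of x, symmetric]) (simp add: nn_integral_distr)

lemma has_bochner_integral_minus_left:
  fixes x :: "'a::euclidean_space" and h :: "'a \<Rightarrow> 'b::{banach, second_countable_topology}"
  assumes h: "has_bochner_integral lborel h I"
  shows "has_bochner_integral lborel (\<lambda>z. h (x - z)) I"
proof -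
  have "integrable lborel h" using h by (simp add: has_bochner_integral_iff)
  from borel_measurable_integrable[OF this] have [measurable]: "h \<in> borel_measurable borel"
    by simp
  have "has_bochner_integral (distr lborel borel (\<lambda>z. x - z)) h I"
    using h by (simp add: distr_lborel_minus_left)
  then show ?thesis
    by (simp add: has_bochner_integral_iff integrable_distr_eq integral_distr)
qed

definition decay_prod :: "'a::euclidean_space \<Rightarrow> real" where
  "decay_prod u = (\<Prod>b\<in>Basis. decay (u \<bullet> b))"

lemma borel_measurable_decay_prod [measurable]: "decay_prod \<in> borel_measurable borel"
  unfolding decay_prod_def[abs_def] by measurable

lemma decay_prod_pos: "decay_prod u > 0"
  unfolding decay_prod_def by (intro prod_pos ballI decay_pos)

lemma decay_prod_nonneg [simp]: "0 \<le> decay_prod u"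
  using decay_prod_pos[of u] by simp

lemma decay_prod_le_1: "decay_prod u \<le> 1"
  unfolding decay_prod_def by (intro prod_le_1 conjI decay_le_1 less_imp_le[OF decay_pos])

lemma integrable_decay_prod: "integrable lborel (decay_prod :: 'a::euclidean_space \<Rightarrow> real)"
proof -
  have "has_bochner_integral lborel (\<lambda>u::'a. \<Prod>b\<in>Basis. decay (u \<bullet> b)) (\<Prod>b\<in>(Basis::'a set). integral\<^sup>L lborel decay)"
    by (intro has_bochner_integral_prod_Basis has_bochner_integral_integrable integrable_decay)
  then show ?thesis
    unfolding decay_prod_def[abs_def] by (simp add: has_bochner_integral_iff)
qed

lemma decay_prod_shift_le:
  fixes u :: "'a::euclidean_space"
  assumes "norm v \<le> 1"
  shows "decay_prod (u + v) \<le> 3 ^ DIM('a) * decay_prod u"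
proof -
  have "decay_prod (u + v) \<le> (\<Prod>b\<in>Basis. 3 * decay (u \<bullet> b))"
    unfolding decay_prod_def inner_add_left
    using assms by (intro prod_mono conjI decay_shift_le less_imp_le[OF decay_pos])
      (meson Basis_le_norm order_trans)
  then show ?thesis by (simp add: decay_prod_def prod.distrib)
qed

lemma cis_sum: "finite S \<Longrightarrow> cis (\<Sum>b\<in>S. h b) = (\<Prod>b\<in>S. cis (h b))"
  by (induction S rule: finite_induct) (auto simp: cis_mult[symmetric])

lemma prod_of_real_cis:
  fixes u \<xi> :: "'a::euclidean_space"
  shows "of_real (\<Prod>b\<in>Basis. k (u \<bullet> b)) * cis (2 * pi * (u \<bullet> \<xi>))
    = (\<Prod>b\<in>Basis. of_real (k (u \<bullet> b)) * cis (2 * pi * (\<xi> \<bullet> b) * (u \<bullet> b)))"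
proof -
  have "2 * pi * (u \<bullet> \<xi>) = (\<Sum>b\<in>Basis. 2 * pi * (\<xi> \<bullet> b) * (u \<bullet> b))"
    by (subst euclidean_inner) (simp add: sum_distrib_left mult_ac)
  then show ?thesis
    by (simp add: cis_sum prod.distrib)
qed

text \<open>A tensor power of the one-dimensional kernel. A frequency in the ball of radius R has
  all coordinates in [-R, R], and there every trapezoid equals 1. The 2 pi in \<open>A\<close>
  matches the phase of the Fourier transform.\<close>

lemma reproducing_kernel:
  fixes R :: real
  assumes R: "R > 0"
  obtains \<phi> :: "'a::euclidean_space \<Rightarrow> real" and D :: real
  where "D > 0" "\<phi> \<in> borel_measurable borel" "\<And>u. \<bar>\<phi> u\<bar> \<le> D * decay_prod u"
    "\<And>u v. norm v \<le> 1 \<Longrightarrow> \<bar>\<phi> (u + v) - \<phi> u\<bar> \<le> D * norm v * decay_prod u"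
    "\<And>\<xi>. norm \<xi> \<le> R \<Longrightarrow> has_bochner_integral lborel (\<lambda>u. of_real (\<phi> u) * cis (2 * pi * (u \<bullet> \<xi>))) 1"
proof -
  define A where "A = 2 * pi * R"
  have A: "A > 0" using R by (simp add: A_def)
  define \<kappa> where "\<kappa> = vp_kernel A"
  obtain C where C: "C > 0" "\<And>t. \<bar>\<kappa> t\<bar> \<le> C * decay t"
    "\<And>s t. \<bar>s\<bar> \<le> 1 \<Longrightarrow> \<bar>\<kappa> (t + s) - \<kappa> t\<bar> \<le> C * \<bar>s\<bar> * decay t"
    using vp_kernel_bounds[OF A] unfolding \<kappa>_def by metis
  have [measurable]: "\<kappa> \<in> borel_measurable borel" unfolding \<kappa>_def by measurable
  define \<phi> :: "'a \<Rightarrow> real" where "\<phi> u = (\<Prod>b\<in>Basis. \<kappa> (u \<bullet> b))" for u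
  define E where "E = (2 * C) ^ DIM('a)"
  have E: "E > 0" using C by (simp add: E_def)
  \<comment> \<open>Dividing every factor by \<open>2 * C * decay\<close> brings it to modulus at
    most 1, as \<open>norm_prod_diff\<close> requires. The 2 leaves room for the factors at shifted
    arguments, which are measured against the decay at the unshifted point.\<close>
  have scale: "(\<Prod>b\<in>Basis. h b) = E * decay_prod u * (\<Prod>b\<in>Basis. h b / (2 * C * decay (u \<bullet> b)))"
    for h :: "'a \<Rightarrow> real" and u :: 'a
  proof -
    have "E * decay_prod u = (\<Prod>b\<in>Basis. 2 * C * decay (u \<bullet> b))"
      by (simp add: E_def decay_prod_def prod.distrib)
    then show ?thesis
      using C decay_pos by (simp add: prod.distrib[symmetric] less_imp_neq[THEN not_sym] cong: prod.cong)
  qed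
  have n: "\<bar>\<kappa> t' / (2 * C * decay t)\<bar> \<le> 1" if "\<bar>\<kappa> t'\<bar> \<le> 2 * C * decay t" for t t'
    using that C decay_pos[of t] by (simp add: divide_simps abs_mult)
  have k2: "\<bar>\<kappa> t\<bar> \<le> 2 * C * decay t" for t
  proof -
    have "C * decay t \<le> 2 * C * decay t" using C(1) decay_pos[of t] by (intro mult_right_mono) auto
    then show ?thesis using C(2)[of t] by linarith
  qed
  have k3: "\<bar>\<kappa> (t + s)\<bar> \<le> 2 * C * decay t" if "\<bar>s\<bar> \<le> 1" for s t
  proof -
    have "\<bar>\<kappa> (t + s) - \<kappa> t\<bar> \<le> C * 1 * decay t"
      using C(3)[OF that, of t] C(1) decay_pos[of t] that
      by (elim order_trans) (intro mult_right_mono mult_left_mono, auto)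
    then show ?thesis using C(2)[of t] by linarith
  qed
  \<comment> \<open>The factor \<open>real DIM('a)\<close> counts the terms in the telescoped
    difference of products.\<close>
  show thesis
  proof (rule that[of "E * real DIM('a)" \<phi>])
    show "E * real DIM('a) > 0" using E by simp
    show "\<phi> \<in> borel_measurable borel" unfolding \<phi>_def[abs_def] by measurable
    fix u :: 'a
    have le: "E * decay_prod u * y \<le> E * real DIM('a) * decay_prod u * x"
      if "y \<le> real DIM('a) * x" for x y
      using mult_left_mono[OF that, of "E * decay_prod u"] E by (simp add: mult_ac)
    have "\<bar>\<phi> u\<bar> = E * decay_prod u * \<bar>\<Prod>b\<in>Basis. \<kappa> (u \<bullet> b) / (2 * C * decay (u \<bullet> b))\<bar>"
      unfolding \<phi>_def scale[of "\<lambda>b. \<kappa> (u \<bullet> b)" u] using E by (simp add: abs_mult)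
    also have "\<dots> \<le> E * real DIM('a) * decay_prod u * 1"
    proof (rule le)
      have "\<bar>\<Prod>b\<in>(Basis::'a set). \<kappa> (u \<bullet> b) / (2 * C * decay (u \<bullet> b))\<bar> \<le> 1"
        unfolding abs_prod by (intro prod_le_1 conjI abs_ge_zero n k2)
      then show "\<bar>\<Prod>b\<in>(Basis::'a set). \<kappa> (u \<bullet> b) / (2 * C * decay (u \<bullet> b))\<bar> \<le> real DIM('a) * 1"
        using DIM_positive[where 'a='a] by (smt (verit) One_nat_def Suc_leI mult_1_right of_nat_1 of_nat_le_iff)
    qed
    finally show "\<bar>\<phi> u\<bar> \<le> E * real DIM('a) * decay_prod u" by simp
    {
      fix v :: 'a assume v: "norm v \<le> 1"
      have vb: "\<bar>v \<bullet> b\<bar> \<le> norm v" "\<bar>v \<bullet> b\<bar> \<le> 1" if "b \<in> Basis" for b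
        using Basis_le_norm[OF that, of v] v by auto
      let ?z = "\<lambda>b. \<kappa> (u \<bullet> b + v \<bullet> b) / (2 * C * decay (u \<bullet> b))"
      let ?w = "\<lambda>b. \<kappa> (u \<bullet> b) / (2 * C * decay (u \<bullet> b))"
      have "\<bar>\<phi> (u + v) - \<phi> u\<bar> = E * decay_prod u * \<bar>(\<Prod>b\<in>Basis. ?z b) - (\<Prod>b\<in>Basis. ?w b)\<bar>"
        unfolding \<phi>_def inner_add_left scale[of "\<lambda>b. \<kappa> (u \<bullet> b)" u] scale[of "\<lambda>b. \<kappa> (u \<bullet> b + v \<bullet> b)" u]
        using E by (simp add: abs_mult right_diff_distrib[symmetric])
      also have "\<dots> \<le> E * real DIM('a) * decay_prod u * norm v"
      proof (rule le)
        have "\<bar>(\<Prod>b\<in>Basis. ?z b) - (\<Prod>b\<in>Basis. ?w b)\<bar> \<le> (\<Sum>b\<in>Basis. norm (?z b - ?w b))"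
          unfolding real_norm_def[symmetric]
          by (rule norm_prod_diff) (auto simp only: real_norm_def intro!: n k2 k3 vb)
        also have "\<dots> \<le> (\<Sum>b\<in>(Basis::'a set). norm v)"
        proof (rule sum_mono)
          fix b :: 'a assume b: "b \<in> Basis"
          have "norm (?z b - ?w b) = \<bar>\<kappa> (u \<bullet> b + v \<bullet> b) - \<kappa> (u \<bullet> b)\<bar> / (2 * C * decay (u \<bullet> b))"
            using C(1) decay_pos[of "u \<bullet> b"] by (simp add: diff_divide_distrib[symmetric] abs_mult)
          also have "\<dots> \<le> C * \<bar>v \<bullet> b\<bar> * decay (u \<bullet> b) / (2 * C * decay (u \<bullet> b))"
            using C(1) C(3)[OF vb(2)[OF b], of "u \<bullet> b"] decay_pos[of "u \<bullet> b"] by (intro divide_right_mono) auto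
          also have "\<dots> \<le> norm v"
            using C(1) decay_pos[of "u \<bullet> b"] vb(1)[OF b] by (simp add: field_simps)
          finally show "norm (?z b - ?w b) \<le> norm v" .
        qed
        also have "\<dots> \<le> real DIM('a) * norm v" by (simp add: mult_right_mono)
        finally show "\<bar>(\<Prod>b\<in>Basis. ?z b) - (\<Prod>b\<in>Basis. ?w b)\<bar> \<le> real DIM('a) * norm v" .
      qed
      finally show "\<bar>\<phi> (u + v) - \<phi> u\<bar> \<le> E * real DIM('a) * norm v * decay_prod u"
        by (simp add: mult_ac)
    }
    fix \<xi> :: 'a assume \<xi>: "norm \<xi> \<le> R"
    have "has_bochner_integral lborel
       (\<lambda>u::'a. \<Prod>b\<in>Basis. of_real (\<kappa> (u \<bullet> b)) * cis (2 * pi * (\<xi> \<bullet> b) * (u \<bullet> b))) (\<Prod>b\<in>(Basis::'a set). 1)"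
    proof (rule has_bochner_integral_prod_Basis)
      fix b :: 'a assume "b \<in> Basis"
      then have "\<bar>\<xi> \<bullet> b\<bar> \<le> R" using Basis_le_norm[of b \<xi>] \<xi> by linarith
      then have "\<bar>2 * pi * (\<xi> \<bullet> b)\<bar> \<le> A" by (simp add: A_def abs_mult)
      then show "has_bochner_integral lborel (\<lambda>t. of_real (\<kappa> t) * cis (2 * pi * (\<xi> \<bullet> b) * t)) 1"
        unfolding \<kappa>_def by (rule has_integral_vp_kernel_cis[OF A])
    qed
    then show "has_bochner_integral lborel (\<lambda>u. of_real (\<phi> u) * cis (2 * pi * (u \<bullet> \<xi>))) 1"
      unfolding \<phi>_def prod_of_real_cis by simp
  qed
qed

section \<open>Fejer weights in several variables\<close>

definition fejer_prod :: "real \<Rightarrow> 'a::euclidean_space \<Rightarrow> real" where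
  "fejer_prod c u = (\<Prod>b\<in>Basis. fejer c (u \<bullet> b))"

lemma borel_measurable_fejer_prod [measurable]: "fejer_prod c \<in> borel_measurable borel"
  unfolding fejer_prod_def[abs_def] by measurable

lemma fejer_prod_nonneg [simp]: "0 \<le> fejer_prod c u"
  unfolding fejer_prod_def by (intro prod_nonneg ballI fejer_nonneg)

lemma integrable_fejer_prod: "integrable lborel (fejer_prod c :: 'a::euclidean_space \<Rightarrow> real)"
proof -
  have "has_bochner_integral lborel (\<lambda>u::'a. \<Prod>b\<in>Basis. fejer c (u \<bullet> b)) (\<Prod>b\<in>(Basis::'a set). integral\<^sup>L lborel (fejer c))"
    by (intro has_bochner_integral_prod_Basis has_bochner_integral_integrable integrable_fejer)
  then show ?thesis
    unfolding fejer_prod_def[abs_def] by (simp add: has_bochner_integral_iff)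
qed

lemma fejer_prod_tendsto_1: "(\<lambda>n. fejer_prod (1 / real (Suc n)) u) \<longlonglongrightarrow> 1"
  using tendsto_prod[of Basis "\<lambda>b n. fejer (1 / real (Suc n)) (u \<bullet> b)" "\<lambda>_. 1" sequentially] fejer_tendsto_1
  by (simp add: fejer_prod_def)

definition fejer_hat :: "real \<Rightarrow> 'a::euclidean_space \<Rightarrow> complex" where
  "fejer_hat c v = (LINT u|lborel. of_real (fejer_prod c u) * cis (2 * pi * (u \<bullet> v)))"

lemma borel_measurable_fejer_hat [measurable]: "fejer_hat c \<in> borel_measurable borel"
  unfolding fejer_hat_def[abs_def] by measurable

text \<open>Each coordinate contributes at most a box of height \<open>2 * fejer_const / c\<close>
  over an interval of length \<open>c / pi\<close>, so c cancels. This uniformity lets the bound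
  survive the limit c -> 0.\<close>

lemma nn_integral_fejer_hat_le:
  assumes c: "c > 0"
  shows "(\<integral>\<^sup>+v. norm (fejer_hat c (v :: 'a::euclidean_space)) \<partial>lborel) \<le> ennreal ((2 * fejer_const / pi) ^ DIM('a))"
proof -
  let ?h = "\<lambda>t::real. ennreal (2 * fejer_const / c * indicator {- (c / (2 * pi))..c / (2 * pi)} t)"
  have "norm (fejer_hat c v) \<le> (\<Prod>b\<in>Basis. 2 * fejer_const / c * indicator {- (c / (2 * pi))..c / (2 * pi)} (v \<bullet> b))"
    for v :: 'a
  proof -
    have "integrable lborel (\<lambda>t. of_real (fejer c t) * cis (2 * pi * (v \<bullet> b) * t))" for b
      by (rule Bochner_Integration.integrable_bound[OF integrable_fejer[of c]]) (auto simp: norm_mult)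
    then have "has_bochner_integral lborel
       (\<lambda>u::'a. \<Prod>b\<in>Basis. of_real (fejer c (u \<bullet> b)) * cis (2 * pi * (v \<bullet> b) * (u \<bullet> b)))
       (\<Prod>b\<in>Basis. (LINT t|lborel. of_real (fejer c t) * cis (2 * pi * (v \<bullet> b) * t)))"
      by (intro has_bochner_integral_prod_Basis has_bochner_integral_integrable)
    then have "fejer_hat c v = (\<Prod>b\<in>Basis. (LINT t|lborel. of_real (fejer c t) * cis (2 * pi * (v \<bullet> b) * t)))"
      unfolding fejer_hat_def fejer_prod_def prod_of_real_cis by (rule has_bochner_integral_integral_eq)
    also have "norm \<dots> \<le> (\<Prod>b\<in>Basis. 2 * fejer_const / c * indicator {- c..c} (2 * pi * (v \<bullet> b)))"
      unfolding prod_norm[symmetric]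
      by (intro prod_mono conjI norm_ge_zero norm_integral_fejer_cis c)
    also have "\<dots> = (\<Prod>b\<in>Basis. 2 * fejer_const / c * indicator {- (c / (2 * pi))..c / (2 * pi)} (v \<bullet> b))"
      by (intro prod.cong) (auto simp: indicator_def field_simps)
    finally show ?thesis .
  qed
  then have "(\<integral>\<^sup>+v. norm (fejer_hat c (v :: 'a)) \<partial>lborel) \<le> (\<integral>\<^sup>+v. (\<Prod>b\<in>Basis. ?h (v \<bullet> b)) \<partial>(lborel :: 'a measure))"
    using fejer_const_pos c by (intro nn_integral_mono) (subst prod_ennreal, auto intro!: ennreal_leI)
  also have "\<dots> = (\<Prod>b\<in>(Basis::'a set). \<integral>\<^sup>+t. ?h t \<partial>lborel)"
    by (rule nn_integral_lborel_prod) auto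
  also have "(\<integral>\<^sup>+t. ?h t \<partial>lborel) = ennreal (2 * fejer_const / pi)"
  proof -
    have "?h t = ennreal (2 * fejer_const / c) * indicator {- (c / (2 * pi))..c / (2 * pi)} t" for t
      by (auto split: split_indicator)
    then have "(\<integral>\<^sup>+t. ?h t \<partial>lborel) = ennreal (2 * fejer_const / c) * ennreal (c / pi)"
      using c by (simp add: nn_integral_cmult_indicator)
    also have "\<dots> = ennreal (2 * fejer_const / pi)"
      using fejer_const_pos c by (simp add: ennreal_mult[symmetric])
    finally show ?thesis .
  qed
  also have "(\<Prod>b\<in>(Basis::'a set). ennreal (2 * fejer_const / pi)) = ennreal ((2 * fejer_const / pi) ^ DIM('a))"
    using fejer_const_pos by (simp add: ennreal_power)
  finally show ?thesis .
qed

section \<open>Band-limited functions\<close>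

lemma borel_measurable_cnj [measurable]: "cnj \<in> borel_measurable borel"
  by (intro borel_measurable_continuous_onI continuous_on_cnj continuous_on_id)

text \<open>If \<open>h\<close> is not integrable, its Bochner integral is 0 by convention, so the
  bound can be applied without checking integrability.\<close>

lemma norm_integral_le_nn_integral:
  fixes h :: "'a \<Rightarrow> 'b::{banach, second_countable_topology}"
  shows "ennreal (norm (integral\<^sup>L M h)) \<le> (\<integral>\<^sup>+x. ennreal (norm (h x)) \<partial>M)"
  by (cases "integrable M h") (auto simp: integral_norm_bound_ennreal not_integrable_integral_eq)

text \<open>The transform over \<open>lborel\<close> rather than its completion: for Borel spectra,
  joint measurability and Fubini are then directly at hand.\<close>

definition fourier_lborel :: "('a::euclidean_space \<Rightarrow> complex) \<Rightarrow> 'a \<Rightarrow> complex" where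
  "fourier_lborel F x = (LINT \<xi>|lborel. cis (- 2 * pi * (x \<bullet> \<xi>)) * F \<xi>)"

text \<open>\<open>F\<close> is here a Borel representative of the spectrum that vanishes everywhere, not only almost
  everywhere, outside the ball.\<close>

definition band_spectrum :: "real \<Rightarrow> ('a::euclidean_space \<Rightarrow> complex) \<Rightarrow> bool" where
  "band_spectrum R F \<longleftrightarrow> F \<in> borel_measurable borel \<and> integrable lborel (\<lambda>\<xi>. (cmod (F \<xi>))\<^sup>2) \<and>
     (\<forall>\<xi>. R < norm \<xi> \<longrightarrow> F \<xi> = 0)"

lemma completion_ex_borel_measurable_complex:
  fixes g :: "'a \<Rightarrow> complex"
  assumes g: "g \<in> borel_measurable (completion M)"
  shows "\<exists>g'\<in>borel_measurable M. (AE x in M. g x = g' x)"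
proof -
  have "(\<lambda>x. Re (g x)) \<in> borel_measurable (completion M)" "(\<lambda>x. Im (g x)) \<in> borel_measurable (completion M)"
    using g by measurable
  from this[THEN completion_ex_borel_measurable_real]
  obtain a b where ab: "a \<in> borel_measurable M" "b \<in> borel_measurable M"
    and ae: "AE x in M. Re (g x) = a x" "AE x in M. Im (g x) = b x"
    by blast
  show ?thesis
  proof
    show "(\<lambda>x. Complex (a x) (b x)) \<in> borel_measurable M"
      using ab by (simp add: Complex_eq)
    show "AE x in M. g x = Complex (a x) (b x)"
      using ae by eventually_elim (simp add: complex_eq_iff)
  qed
qed

text \<open>A Lebesgue measurable spectrum agrees almost everywhere with a Borel function, which is
  then cut off outside the ball. Changing a spectrum on a null set alters its transform at no
  point.\<close>

lemma PW2_band_spectrum: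
  fixes \<Omega> :: "'a::euclidean_space set"
  assumes f: "f \<in> PW2 \<Omega>" and \<Omega>: "\<Omega> \<subseteq> cball 0 R"
  obtains F where "band_spectrum R F" "f = fourier_lborel F"
proof -
  obtain F where F: "F \<in> borel_measurable lebesgue" "integrable lebesgue (\<lambda>\<xi>. (cmod (F \<xi>))\<^sup>2)"
    "AE \<xi> in lebesgue. \<xi> \<notin> \<Omega> \<longrightarrow> F \<xi> = 0" and fF: "f = fourier_transform F"
    using f unfolding PW2_def by auto
  obtain G where G [measurable]: "G \<in> borel_measurable lborel" and FG: "AE \<xi> in lborel. F \<xi> = G \<xi>"
    using completion_ex_borel_measurable_complex[OF F(1)] by blast
  define H where "H \<xi> = indicator (cball 0 R) \<xi> * G \<xi>" for \<xi>
  have [measurable]: "G \<in> borel_measurable borel" using G by simp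
  have [measurable]: "H \<in> borel_measurable borel"
    unfolding H_def by (intro borel_measurable_times borel_measurable_indicator) auto
  have FH: "AE \<xi> in lebesgue. F \<xi> = H \<xi>"
    using AE_completion[OF FG] F(3)
  proof eventually_elim
    case (elim \<xi>)
    then show ?case using \<Omega> by (auto simp: H_def indicator_def)
  qed
  have "integrable lebesgue (\<lambda>\<xi>. (cmod (H \<xi>))\<^sup>2)"
    by (rule integrable_cong_AE_imp[OF F(2)]) (use FH in \<open>auto simp: measurable_completion\<close>)
  then have "integrable lborel (\<lambda>\<xi>. (cmod (H \<xi>))\<^sup>2)"
    by (subst (asm) integrable_completion) auto
  then have "band_spectrum R H"
    by (auto simp: band_spectrum_def H_def indicator_def)
  moreover have "f x = fourier_lborel H x" for x
  proof -
    have "f x = (LINT \<xi>|lebesgue. cis (- 2 * pi * (x \<bullet> \<xi>)) * F \<xi>)"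
      by (simp add: fF fourier_transform_def)
    also have "\<dots> = (LINT \<xi>|lebesgue. cis (- 2 * pi * (x \<bullet> \<xi>)) * H \<xi>)"
    proof (rule integral_cong_AE)
      show "(\<lambda>\<xi>. cis (- 2 * pi * (x \<bullet> \<xi>)) * F \<xi>) \<in> borel_measurable lebesgue"
        by (rule borel_measurable_times[OF measurable_completion F(1)]) simp
      show "(\<lambda>\<xi>. cis (- 2 * pi * (x \<bullet> \<xi>)) * H \<xi>) \<in> borel_measurable lebesgue"
        by (intro measurable_completion) auto
    qed (use FH in auto)
    also have "\<dots> = fourier_lborel H x"
      unfolding fourier_lborel_def by (rule integral_completion) auto
    finally show ?thesis .
  qed
  ultimately show thesis using that by blast
qed

locale bandlimited =
  fixes R :: real and F f :: "'a::euclidean_space \<Rightarrow> complex"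
  assumes F: "band_spectrum R F" and f_eq: "f = fourier_lborel F"
begin

lemma borel_measurable_F [measurable]: "F \<in> borel_measurable borel"
  using F by (simp add: band_spectrum_def)

lemma borel_measurable_f [measurable]: "f \<in> borel_measurable borel"
  unfolding f_eq fourier_lborel_def[abs_def] by measurable

text \<open>On the ball |F| <= |F|^2 + 1, and the ball has finite measure.\<close>

lemma integrable_F: "integrable lborel F"
proof (rule Bochner_Integration.integrable_bound)
  show "integrable lborel (\<lambda>\<xi>. (cmod (F \<xi>))\<^sup>2 + indicator (cball 0 R) \<xi>)"
    using F emeasure_bounded_finite[OF bounded_cball, of "0::'a" R]
    by (auto simp: band_spectrum_def intro!: integrable_real_indicator Bochner_Integration.integrable_add)
  show "AE \<xi> in lborel. norm (F \<xi>) \<le> norm ((cmod (F \<xi>))\<^sup>2 + indicator (cball 0 R) \<xi> :: real)"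
  proof (rule AE_I2)
    fix \<xi>
    have "y \<le> y\<^sup>2 + 1" if "0 \<le> y" for y :: real
      using zero_le_power2[of "y - 1"] that by (simp add: power2_eq_square algebra_simps)
    moreover have "F \<xi> = 0" if "\<xi> \<notin> cball 0 R"
      using F that by (auto simp: band_spectrum_def)
    ultimately show "norm (F \<xi>) \<le> norm ((cmod (F \<xi>))\<^sup>2 + indicator (cball 0 R) \<xi> :: real)"
      by (cases "\<xi> \<in> cball 0 R") auto
  qed
qed simp



lemma integrable_mult_F:
  assumes "k \<in> borel_measurable borel" "\<And>\<xi>. cmod (k \<xi>) \<le> 1"
  shows "integrable lborel (\<lambda>\<xi>. k \<xi> * F \<xi>)"
  using assms by (intro Bochner_Integration.integrable_bound[OF integrable_F])
    (auto simp: norm_mult intro!: mult_left_le_one_le)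

lemma f_bound: "cmod (f x) \<le> (LINT \<xi>|lborel. cmod (F \<xi>))"
  unfolding f_eq fourier_lborel_def
  by (rule order_trans[OF integral_norm_bound]) (simp add: norm_mult)

lemma F_square_nn_integral: "(\<integral>\<^sup>+\<xi>. ennreal ((cmod (F \<xi>))\<^sup>2) \<partial>lborel) < \<infinity>"
  using F by (simp add: band_spectrum_def integrable_iff_bounded)

lemma integrable_kernel:
  assumes k: "integrable lborel k"
    and a: "case_prod a \<in> borel_measurable (borel \<Otimes>\<^sub>M borel)"
  shows "integrable (lborel \<Otimes>\<^sub>M lborel) (\<lambda>(z, \<xi>). k z * (cis (a z \<xi>) * F \<xi>))"
proof (rule lborel_pair.Fubini_integrable)
  have [measurable]: "k \<in> borel_measurable borel" using k by auto
  have [measurable]: "(\<lambda>x. a (fst x) (snd x)) \<in> borel_measurable (borel \<Otimes>\<^sub>M borel)"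
    using a by (simp add: case_prod_beta')
  show "(\<lambda>(z, \<xi>). k z * (cis (a z \<xi>) * F \<xi>)) \<in> borel_measurable (lborel \<Otimes>\<^sub>M lborel)"
    by measurable
  have "(LINT \<xi>|lborel. norm (case (z, \<xi>) of (z, \<xi>) \<Rightarrow> k z * (cis (a z \<xi>) * F \<xi>)))
      = norm (k z) * (LINT \<xi>|lborel. cmod (F \<xi>))" for z
    by (simp add: norm_mult)
  then show "integrable lborel (\<lambda>z. LINT \<xi>|lborel. norm (case (z, \<xi>) of (z, \<xi>) \<Rightarrow> k z * (cis (a z \<xi>) * F \<xi>)))"
    using k by (simp del: norm_mult)
  show "AE z in lborel. integrable lborel (\<lambda>\<xi>. case (z, \<xi>) of (z, \<xi>) \<Rightarrow> k z * (cis (a z \<xi>) * F \<xi>))"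
  proof (rule AE_I2, unfold prod.case)
    fix z
    have "(\<lambda>\<xi>. case_prod a (z, \<xi>)) \<in> borel_measurable borel"
      by (rule measurable_compose[OF measurable_Pair1' a]) simp
    then have "integrable lborel (\<lambda>\<xi>. cis (a z \<xi>) * F \<xi>)"
      by (intro integrable_mult_F) auto
    then show "integrable lborel (\<lambda>\<xi>. k z * (cis (a z \<xi>) * F \<xi>))"
      by (rule integrable_mult_right)
  qed
qed

text \<open>The multiplication formula: Fubini moves the Fourier transform from the spectrum to
  \<open>k\<close>. It serves the reproducing identity and, applied twice, the Plancherel
  estimate.\<close>

lemma integral_mult_f:
  assumes k: "integrable lborel k"
  shows "(LINT z|lborel. k z * f z) = (LINT \<xi>|lborel. F \<xi> * (LINT z|lborel. k z * cis (- 2 * pi * (z \<bullet> \<xi>))))"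
proof -
  have "(LINT z|lborel. k z * f z) = (LINT z|lborel. LINT \<xi>|lborel. k z * (cis (- 2 * pi * (z \<bullet> \<xi>)) * F \<xi>))"
    by (simp add: f_eq fourier_lborel_def)
  also have "\<dots> = (LINT \<xi>|lborel. LINT z|lborel. k z * (cis (- 2 * pi * (z \<bullet> \<xi>)) * F \<xi>))"
    by (rule lborel_pair.Fubini_integral[symmetric]) (use integrable_kernel[OF k] in auto)
  also have "\<dots> = (LINT \<xi>|lborel. F \<xi> * (LINT z|lborel. k z * cis (- 2 * pi * (z \<bullet> \<xi>))))"
    by (intro Bochner_Integration.integral_cong refl, subst integral_mult_right_zero[symmetric]) (simp add: mult_ac)
  finally show ?thesis .
qed

lemma f_reproducing:
  fixes \<phi> :: "'a \<Rightarrow> real"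
  assumes \<phi>: "integrable lborel \<phi>"
    and id: "\<And>\<xi>. norm \<xi> \<le> R \<Longrightarrow> has_bochner_integral lborel (\<lambda>u. of_real (\<phi> u) * cis (2 * pi * (u \<bullet> \<xi>))) 1"
  shows "f x = (LINT z|lborel. of_real (\<phi> (x - z)) * f z)"
proof -
  have "has_bochner_integral lborel (\<lambda>z. \<phi> (x - z)) (integral\<^sup>L lborel \<phi>)"
    using \<phi> by (intro has_bochner_integral_minus_left has_bochner_integral_integrable)
  then have "integrable lborel (\<lambda>z. complex_of_real (\<phi> (x - z)))"
    by (simp add: has_bochner_integral_iff)
  then have "(LINT z|lborel. of_real (\<phi> (x - z)) * f z)
      = (LINT \<xi>|lborel. F \<xi> * (LINT z|lborel. of_real (\<phi> (x - z)) * cis (- 2 * pi * (z \<bullet> \<xi>))))"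
    by (rule integral_mult_f)
  also have "\<dots> = (LINT \<xi>|lborel. cis (- 2 * pi * (x \<bullet> \<xi>)) * F \<xi>)"
  proof (intro Bochner_Integration.integral_cong refl)
    fix \<xi> :: 'a
    show "F \<xi> * (LINT z|lborel. of_real (\<phi> (x - z)) * cis (- 2 * pi * (z \<bullet> \<xi>))) = cis (- 2 * pi * (x \<bullet> \<xi>)) * F \<xi>"
    proof (cases "norm \<xi> \<le> R")
      case True
      from has_bochner_integral_mult_right[OF has_bochner_integral_minus_left[OF id[OF True], of x], of "cis (- 2 * pi * (x \<bullet> \<xi>))"]
      have "has_bochner_integral lborel
        (\<lambda>z. cis (- 2 * pi * (x \<bullet> \<xi>)) * (of_real (\<phi> (x - z)) * cis (2 * pi * ((x - z) \<bullet> \<xi>)))) (cis (- 2 * pi * (x \<bullet> \<xi>)))"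
        by simp
      moreover have "cis (- 2 * pi * (x \<bullet> \<xi>)) * (of_real (\<phi> (x - z)) * cis (2 * pi * ((x - z) \<bullet> \<xi>)))
          = of_real (\<phi> (x - z)) * cis (- 2 * pi * (z \<bullet> \<xi>))" for z
      proof -
        have "cis (- 2 * pi * (x \<bullet> \<xi>)) * cis (2 * pi * ((x - z) \<bullet> \<xi>)) = cis (- 2 * pi * (z \<bullet> \<xi>))"
          by (simp add: cis_mult inner_diff_left algebra_simps)
        then show ?thesis by (metis mult.left_commute)
      qed
      ultimately have "has_bochner_integral lborel (\<lambda>z. of_real (\<phi> (x - z)) * cis (- 2 * pi * (z \<bullet> \<xi>)))
          (cis (- 2 * pi * (x \<bullet> \<xi>)))"
        by (simp only:)
      from has_bochner_integral_integral_eq[OF this] show ?thesis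
        by (simp only: mult.commute)
    next
      case False
      then show ?thesis using F by (simp add: band_spectrum_def)
    qed
  qed
  finally show ?thesis by (simp add: f_eq fourier_lborel_def)
qed

text \<open>Half of Plancherel's theorem, with a nonoptimal constant: the mass of \<open>f\<close> against the weight
  \<open>fejer_prod c\<close> is a Hermitian form in \<open>F\<close> with kernel \<open>fejer_hat c\<close>, which is bounded by Schur's test
  uniformly in \<open>c\<close>; then let \<open>c\<close> tend to \<open>0\<close>.\<close>

lemma nn_integral_f_fejer_le:
  assumes c: "c > 0"
  shows "(\<integral>\<^sup>+x. ennreal ((cmod (f x))\<^sup>2 * fejer_prod c x) \<partial>lborel)
    \<le> 2 * ennreal ((2 * fejer_const / pi) ^ DIM('a)) * (\<integral>\<^sup>+\<xi>. ennreal ((cmod (F \<xi>))\<^sup>2) \<partial>lborel)"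
proof -
  let ?M = "LINT \<xi>|lborel. cmod (F \<xi>)"
  let ?K = "ennreal ((2 * fejer_const / pi) ^ DIM('a))"
  have M: "0 \<le> ?M" by (rule Bochner_Integration.integral_nonneg) simp
  \<comment> \<open>At this stage \<open>f\<close> is known to be bounded but not to be square
    integrable; the Fejer weight supplies the integrability that the multiplication formula
    demands.\<close>
  have w: "integrable lborel (\<lambda>x. complex_of_real (fejer_prod c x) * h x)"
    if [measurable]: "h \<in> borel_measurable borel" and h: "\<And>x. cmod (h x) \<le> B" for h :: "'a \<Rightarrow> complex" and B
  proof (rule Bochner_Integration.integrable_bound[OF integrable_mult_right[OF integrable_fejer_prod[of c], of B]])
    show "AE x in lborel. norm (complex_of_real (fejer_prod c x) * h x) \<le> norm (B * fejer_prod c x)"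
    proof (rule AE_I2)
      fix x
      have "norm (complex_of_real (fejer_prod c x) * h x) \<le> fejer_prod c x * B"
        using h by (simp add: norm_mult mult_left_mono)
      also have "\<dots> \<le> norm (B * fejer_prod c x)" by (simp add: mult.commute)
      finally show "norm (complex_of_real (fejer_prod c x) * h x) \<le> norm (B * fejer_prod c x)" .
    qed
  qed measurable
  \<comment> \<open>\<open>E\<close> is the weighted mass, written so that the multiplication
    formula first replaces the right factor \<open>f\<close>; \<open>inner\<close> then treats the
    conjugated factor the same way.\<close>
  define E where "E = (LINT x|lborel. (of_real (fejer_prod c x) * cnj (f x)) * f x)"
  have inner: "(LINT x|lborel. (of_real (fejer_prod c x) * cnj (f x)) * cis (- 2 * pi * (x \<bullet> \<xi>)))
      = cnj (LINT \<eta>|lborel. F \<eta> * fejer_hat c (\<xi> - \<eta>))" for \<xi>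
  proof -
    have k: "integrable lborel (\<lambda>x. complex_of_real (fejer_prod c x) * cis (2 * pi * (x \<bullet> \<xi>)))"
      by (rule w[of _ 1]) auto
    have "(LINT x|lborel. (of_real (fejer_prod c x) * cis (2 * pi * (x \<bullet> \<xi>))) * f x)
      = (LINT \<eta>|lborel. F \<eta> * (LINT x|lborel. (of_real (fejer_prod c x) * cis (2 * pi * (x \<bullet> \<xi>))) * cis (- 2 * pi * (x \<bullet> \<eta>))))"
      by (rule integral_mult_f[OF k])
    also have "\<dots> = (LINT \<eta>|lborel. F \<eta> * fejer_hat c (\<xi> - \<eta>))"
      by (simp add: fejer_hat_def cis_mult mult.assoc inner_diff_right right_diff_distrib)
    finally have "cnj (LINT \<eta>|lborel. F \<eta> * fejer_hat c (\<xi> - \<eta>))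
       = (LINT x|lborel. cnj ((of_real (fejer_prod c x) * cis (2 * pi * (x \<bullet> \<xi>))) * f x))"
      by (simp only: Bochner_Integration.integral_cnj)
    then show ?thesis by (simp add: cis_cnj mult_ac)
  qed
  have "E = (LINT \<xi>|lborel. F \<xi> * (LINT x|lborel. (of_real (fejer_prod c x) * cnj (f x)) * cis (- 2 * pi * (x \<bullet> \<xi>))))"
    unfolding E_def by (rule integral_mult_f, rule w[of _ ?M]) (auto simp: f_bound)
  then have E: "E = (LINT \<xi>|lborel. F \<xi> * cnj (LINT \<eta>|lborel. F \<eta> * fejer_hat c (\<xi> - \<eta>)))"
    by (simp only: inner)
  have "ennreal (norm E) \<le> (\<integral>\<^sup>+\<xi>. norm (F \<xi> * cnj (LINT \<eta>|lborel. F \<eta> * fejer_hat c (\<xi> - \<eta>))) \<partial>lborel)"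
    unfolding E by (rule norm_integral_le_nn_integral)
  also have "\<dots> \<le> (\<integral>\<^sup>+\<xi>. ennreal (cmod (F \<xi>)) * (\<integral>\<^sup>+\<eta>. ennreal (cmod (F \<eta> * fejer_hat c (\<xi> - \<eta>))) \<partial>lborel) \<partial>lborel)"
  proof (rule nn_integral_mono)
    fix \<xi> :: 'a
    have "ennreal (norm (F \<xi> * cnj (LINT \<eta>|lborel. F \<eta> * fejer_hat c (\<xi> - \<eta>))))
        = ennreal (cmod (F \<xi>)) * ennreal (norm (LINT \<eta>|lborel. F \<eta> * fejer_hat c (\<xi> - \<eta>)))"
      by (simp only: norm_mult complex_mod_cnj ennreal_mult[OF norm_ge_zero norm_ge_zero])
    also have "\<dots> \<le> ennreal (cmod (F \<xi>)) * (\<integral>\<^sup>+\<eta>. ennreal (cmod (F \<eta> * fejer_hat c (\<xi> - \<eta>))) \<partial>lborel)"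
      by (intro mult_left_mono norm_integral_le_nn_integral) simp
    finally show "ennreal (norm (F \<xi> * cnj (LINT \<eta>|lborel. F \<eta> * fejer_hat c (\<xi> - \<eta>)))) \<le> \<dots>" .
  qed
  also have "\<dots> = (\<integral>\<^sup>+\<xi>. \<integral>\<^sup>+\<eta>. ennreal (cmod (F \<xi>)) * ennreal (cmod (F \<eta> * fejer_hat c (\<xi> - \<eta>))) \<partial>lborel \<partial>lborel)"
    by (intro nn_integral_cong nn_integral_cmult[symmetric]) auto
  also have "\<dots> \<le> (\<integral>\<^sup>+\<xi>. \<integral>\<^sup>+\<eta>. ennreal ((cmod (F \<xi>))\<^sup>2) * ennreal (norm (fejer_hat c (\<xi> - \<eta>)))
       + ennreal ((cmod (F \<eta>))\<^sup>2) * ennreal (norm (fejer_hat c (\<xi> - \<eta>))) \<partial>lborel \<partial>lborel)"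
  proof (intro nn_integral_mono)
    fix \<xi> \<eta> :: 'a
    \<comment> \<open>Schur's test for a convolution kernel: after this inequality each summand
      carries the spectrum in one variable only, and the other variable integrates the kernel alone.
      The two summands give the factor 2 of the claim.\<close>
    have "a * (b * d) \<le> a\<^sup>2 * d + b\<^sup>2 * d" if "0 \<le> a" "0 \<le> b" "0 \<le> d" for a b d :: real
    proof -
      have "2 * (a * b) \<le> a\<^sup>2 + b\<^sup>2" using sum_squares_bound[of a b] by simp
      then have "a * b \<le> a\<^sup>2 + b\<^sup>2" using that mult_nonneg_nonneg[of a b] by linarith
      from mult_right_mono[OF this \<open>0 \<le> d\<close>] show ?thesis by (simp add: algebra_simps)
    qed
    then show "ennreal (cmod (F \<xi>)) * ennreal (cmod (F \<eta> * fejer_hat c (\<xi> - \<eta>)))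
      \<le> ennreal ((cmod (F \<xi>))\<^sup>2) * ennreal (norm (fejer_hat c (\<xi> - \<eta>)))
       + ennreal ((cmod (F \<eta>))\<^sup>2) * ennreal (norm (fejer_hat c (\<xi> - \<eta>)))"
      by (simp add: norm_mult ennreal_mult[symmetric] ennreal_plus[symmetric] del: ennreal_plus)
  qed
  also have "\<dots> = (\<integral>\<^sup>+\<xi>. \<integral>\<^sup>+\<eta>. ennreal ((cmod (F \<xi>))\<^sup>2) * ennreal (norm (fejer_hat c (\<xi> - \<eta>))) \<partial>lborel \<partial>lborel)
       + (\<integral>\<^sup>+\<xi>. \<integral>\<^sup>+\<eta>. ennreal ((cmod (F \<eta>))\<^sup>2) * ennreal (norm (fejer_hat c (\<xi> - \<eta>))) \<partial>lborel \<partial>lborel)"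
    by (subst nn_integral_add[symmetric]) (auto intro!: nn_integral_cong nn_integral_add)
  also have "(\<integral>\<^sup>+\<xi>. \<integral>\<^sup>+\<eta>. ennreal ((cmod (F \<eta>))\<^sup>2) * ennreal (norm (fejer_hat c (\<xi> - \<eta>))) \<partial>lborel \<partial>lborel)
      = (\<integral>\<^sup>+\<eta>. \<integral>\<^sup>+\<xi>. ennreal ((cmod (F \<eta>))\<^sup>2) * ennreal (norm (fejer_hat c (\<xi> - \<eta>))) \<partial>lborel \<partial>lborel)"
    by (rule lborel_pair.Fubini'[symmetric]) auto
  also have "\<dots> = (\<integral>\<^sup>+\<eta>. ennreal ((cmod (F \<eta>))\<^sup>2) * (\<integral>\<^sup>+\<xi>. ennreal (norm (fejer_hat c (- \<eta> + \<xi>))) \<partial>lborel) \<partial>lborel)"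
    by (intro nn_integral_cong) (auto simp: nn_integral_cmult)
  also have "\<dots> \<le> (\<integral>\<^sup>+\<eta>. ennreal ((cmod (F \<eta>))\<^sup>2) * ?K \<partial>lborel)"
    using nn_integral_fejer_hat_le[OF c, where 'a='a]
    by (subst nn_integral_plus_left[of "\<lambda>v. ennreal (norm (fejer_hat c v))"]) (auto intro!: nn_integral_mono mult_left_mono)
  also have "(\<integral>\<^sup>+\<xi>. \<integral>\<^sup>+\<eta>. ennreal ((cmod (F \<xi>))\<^sup>2) * ennreal (norm (fejer_hat c (\<xi> - \<eta>))) \<partial>lborel \<partial>lborel)
      = (\<integral>\<^sup>+\<eta>. ennreal ((cmod (F \<eta>))\<^sup>2) * (\<integral>\<^sup>+\<xi>. ennreal (norm (fejer_hat c (\<eta> - \<xi>))) \<partial>lborel) \<partial>lborel)"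
    by (intro nn_integral_cong) (auto simp: nn_integral_cmult)
  also have "\<dots> \<le> (\<integral>\<^sup>+\<eta>. ennreal ((cmod (F \<eta>))\<^sup>2) * ?K \<partial>lborel)"
    using nn_integral_fejer_hat_le[OF c, where 'a='a]
    by (subst nn_integral_minus_left[of "\<lambda>v. ennreal (norm (fejer_hat c v))"]) (auto intro!: nn_integral_mono mult_left_mono)
  also have "(\<integral>\<^sup>+\<eta>. ennreal ((cmod (F \<eta>))\<^sup>2) * ?K \<partial>lborel) = (\<integral>\<^sup>+\<xi>. ennreal ((cmod (F \<xi>))\<^sup>2) \<partial>lborel) * ?K"
    by (rule nn_integral_multc) auto
  finally have le: "ennreal (norm E) \<le> 2 * ?K * (\<integral>\<^sup>+\<xi>. ennreal ((cmod (F \<xi>))\<^sup>2) \<partial>lborel)"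
    by (simp add: mult_ac add_right_mono mult_2[symmetric] mult_2_right[symmetric])
  have "(\<lambda>x. (of_real (fejer_prod c x) * cnj (f x)) * f x) = (\<lambda>x. complex_of_real ((cmod (f x))\<^sup>2 * fejer_prod c x))"
    by (auto simp: complex_norm_square mult_ac simp del: of_real_power)
  then have "E = of_real (LINT x|lborel. (cmod (f x))\<^sup>2 * fejer_prod c x)"
    unfolding E_def by (simp only: integral_complex_of_real)
  then have "norm E = (LINT x|lborel. (cmod (f x))\<^sup>2 * fejer_prod c x)"
    by (simp only: norm_of_real) (simp add: Bochner_Integration.integral_nonneg)
  moreover have "integrable lborel (\<lambda>x. (cmod (f x))\<^sup>2 * fejer_prod c x)"
    by (rule Bochner_Integration.integrable_bound[OF integrable_mult_right[OF integrable_fejer_prod[of c], of "?M\<^sup>2"]])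
       (auto simp: abs_mult intro!: mult_right_mono power_mono f_bound)
  ultimately have "(\<integral>\<^sup>+x. ennreal ((cmod (f x))\<^sup>2 * fejer_prod c x) \<partial>lborel) = ennreal (norm E)"
    by (subst nn_integral_eq_integral) auto
  with le show ?thesis by simp
qed

text \<open>Fatou's lemma along c = 1 / (n + 1): the weights converge to 1 at every point and the
  bounds do not depend on n. The absorption in the transfer step relies on this finiteness.\<close>

lemma L2_norm_finite: "(\<integral>\<^sup>+x. ennreal ((cmod (f x))\<^sup>2) \<partial>lborel) < \<infinity>"
proof -
  let ?B = "2 * ennreal ((2 * fejer_const / pi) ^ DIM('a)) * (\<integral>\<^sup>+\<xi>. ennreal ((cmod (F \<xi>))\<^sup>2) \<partial>lborel)"
  let ?g = "\<lambda>n x. ennreal ((cmod (f x))\<^sup>2 * fejer_prod (1 / real (Suc n)) x)"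
  have "ennreal ((cmod (f x))\<^sup>2) = liminf (\<lambda>n. ?g n x)" for x
  proof -
    have "(\<lambda>n. ?g n x) \<longlonglongrightarrow> ennreal ((cmod (f x))\<^sup>2 * 1)"
      by (intro tendsto_ennrealI tendsto_mult tendsto_const fejer_prod_tendsto_1)
    then show ?thesis using lim_imp_Liminf[OF sequentially_bot] by fastforce
  qed
  then have "(\<integral>\<^sup>+x. ennreal ((cmod (f x))\<^sup>2) \<partial>lborel) = (\<integral>\<^sup>+x. liminf (\<lambda>n. ?g n x) \<partial>lborel)"
    by simp
  also have "\<dots> \<le> liminf (\<lambda>n. \<integral>\<^sup>+x. ?g n x \<partial>lborel)"
    by (rule nn_integral_liminf) auto
  also have "\<dots> \<le> liminf (\<lambda>n::nat. ?B)"
    by (intro Liminf_mono always_eventually allI nn_integral_f_fejer_le) simp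
  also have "\<dots> = ?B" by (simp add: Liminf_const)
  also have "\<dots> < \<infinity>"
    using F_square_nn_integral by (simp add: ennreal_mult_less_top)
  finally show ?thesis .
qed

end

section \<open>Local bounds and measures bounded on balls\<close>

definition decay_average :: "('a::euclidean_space \<Rightarrow> complex) \<Rightarrow> 'a \<Rightarrow> ennreal" where
  "decay_average f x = (\<integral>\<^sup>+z. ennreal ((cmod (f z))\<^sup>2) * ennreal (decay_prod (x - z)) \<partial>lborel)"

lemma borel_measurable_decay_average [measurable]:
  assumes [measurable]: "f \<in> borel_measurable borel"
  shows "decay_average f \<in> borel_measurable borel"
  unfolding decay_average_def[abs_def] by measurable

lemma decay_average_le: "decay_average f x \<le> (\<integral>\<^sup>+z. ennreal ((cmod (f z))\<^sup>2) \<partial>lborel)"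
  unfolding decay_average_def
proof (rule nn_integral_mono)
  fix z
  have "ennreal ((cmod (f z))\<^sup>2) * ennreal (decay_prod (x - z)) \<le> ennreal ((cmod (f z))\<^sup>2) * 1"
    by (intro mult_left_mono) (auto simp: decay_prod_le_1)
  then show "ennreal ((cmod (f z))\<^sup>2) * ennreal (decay_prod (x - z)) \<le> ennreal ((cmod (f z))\<^sup>2)"
    by simp
qed

lemma decay_prod_minus: "decay_prod (- u) = decay_prod u"
  by (simp add: decay_prod_def decay_def)

lemma nn_integral_decay_prod:
  fixes x :: "'a::euclidean_space"
  shows "(\<integral>\<^sup>+z. ennreal (decay_prod (x - z)) \<partial>lborel) = ennreal (integral\<^sup>L lborel (decay_prod :: 'a \<Rightarrow> real))"
proof -
  have "(\<integral>\<^sup>+z. ennreal (decay_prod (x - z)) \<partial>lborel) = (\<integral>\<^sup>+z. ennreal (decay_prod (z :: 'a)) \<partial>lborel)"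
    by (rule nn_integral_minus_left) measurable
  also have "\<dots> = ennreal (integral\<^sup>L lborel (decay_prod :: 'a \<Rightarrow> real))"
    by (rule nn_integral_eq_integral[OF integrable_decay_prod]) simp
  finally show ?thesis .
qed

text \<open>Cauchy-Schwarz with the weight split into two square roots: one is integrated alone and
  gives the mass of \<open>decay_prod\<close>, the other stays with \<open>f\<close> and gives
  \<open>decay_average\<close>.\<close>

lemma norm_integral_decay_sq_le:
  fixes f :: "'a::euclidean_space \<Rightarrow> complex" and k :: "'a \<Rightarrow> real"
  assumes [measurable]: "f \<in> borel_measurable borel" "k \<in> borel_measurable borel"
    and k: "\<And>z. \<bar>k z\<bar> \<le> B * decay_prod (x - z)" and B: "B \<ge> 0"
  shows "ennreal ((cmod (LINT z|lborel. of_real (k z) * f z))\<^sup>2)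
    \<le> ennreal (B\<^sup>2 * integral\<^sup>L lborel (decay_prod :: 'a \<Rightarrow> real)) * decay_average f x"
proof -
  let ?s = "\<lambda>z. sqrt (decay_prod (x - z))"
  have W: "0 \<le> integral\<^sup>L lborel (decay_prod :: 'a \<Rightarrow> real)"
    by (rule Bochner_Integration.integral_nonneg) simp
  have "ennreal (cmod (LINT z|lborel. of_real (k z) * f z)) \<le> (\<integral>\<^sup>+z. ennreal (norm (of_real (k z) * f z)) \<partial>lborel)"
    by (rule norm_integral_le_nn_integral)
  also have "\<dots> \<le> (\<integral>\<^sup>+z. ennreal B * (ennreal (?s z) * ennreal (?s z * cmod (f z))) \<partial>lborel)"
  proof (rule nn_integral_mono)
    fix z
    have "norm (of_real (k z) * f z) \<le> (B * decay_prod (x - z)) * cmod (f z)"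
      using k[of z] by (simp add: norm_mult mult_right_mono)
    also have "\<dots> = B * (?s z * (?s z * cmod (f z)))"
      by (simp add: mult.assoc[symmetric])
    finally show "ennreal (norm (of_real (k z) * f z)) \<le> ennreal B * (ennreal (?s z) * ennreal (?s z * cmod (f z)))"
      using B by (simp add: ennreal_mult[symmetric] ennreal_leI)
  qed
  also have "\<dots> = ennreal B * (\<integral>\<^sup>+z. ennreal (?s z) * ennreal (?s z * cmod (f z)) \<partial>lborel)"
    by (rule nn_integral_cmult) measurable
  finally have "(ennreal (cmod (LINT z|lborel. of_real (k z) * f z)))\<^sup>2
     \<le> (ennreal B * (\<integral>\<^sup>+z. ennreal (?s z) * ennreal (?s z * cmod (f z)) \<partial>lborel))\<^sup>2"
    by (rule power_mono) simp
  also have "\<dots> = (ennreal B)\<^sup>2 * (\<integral>\<^sup>+z. ennreal (?s z) * ennreal (?s z * cmod (f z)) \<partial>lborel)\<^sup>2"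
    by (rule power_mult_distrib)
  also have "\<dots> \<le> (ennreal B)\<^sup>2 * ((\<integral>\<^sup>+z. (ennreal (?s z))\<^sup>2 \<partial>lborel) * (\<integral>\<^sup>+z. (ennreal (?s z * cmod (f z)))\<^sup>2 \<partial>lborel))"
    by (intro mult_left_mono Cauchy_Schwarz_nn_integral) auto
  also have "(\<integral>\<^sup>+z. (ennreal (?s z))\<^sup>2 \<partial>lborel) = ennreal (integral\<^sup>L lborel (decay_prod :: 'a \<Rightarrow> real))"
    unfolding nn_integral_decay_prod[of x, symmetric] by (intro nn_integral_cong) (simp add: ennreal_power)
  also have "(\<integral>\<^sup>+z. (ennreal (?s z * cmod (f z)))\<^sup>2 \<partial>lborel) = decay_average f x"
    unfolding decay_average_def
    by (intro nn_integral_cong) (simp add: ennreal_power power_mult_distrib ennreal_mult mult.commute)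
  finally show ?thesis
    using B W by (simp add: ennreal_power ennreal_mult mult.assoc)
qed

text \<open>Both estimates apply Cauchy-Schwarz to the reproducing formula, with the kernel itself
  and with its increment. The constant is chosen before \<open>F\<close> and \<open>f\<close>: it
  depends only on the radius of the spectral ball and the dimension.\<close>

lemma bandlimited_local_bounds:
  fixes R :: real
  assumes R: "R > 0"
  obtains C :: real where "C > 0"
    "\<And>(F :: 'a::euclidean_space \<Rightarrow> complex) f x. bandlimited R F f \<Longrightarrow>
      ennreal ((cmod (f x))\<^sup>2) \<le> ennreal C * decay_average f x"
    "\<And>(F :: 'a::euclidean_space \<Rightarrow> complex) f x y. bandlimited R F f \<Longrightarrow> dist x y \<le> 1 \<Longrightarrow>
      ennreal ((cmod (f y - f x))\<^sup>2) \<le> ennreal (C * (dist x y)\<^sup>2) * decay_average f x"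
proof -
  obtain \<phi> :: "'a \<Rightarrow> real" and D where D: "D > 0" and [measurable]: "\<phi> \<in> borel_measurable borel"
    and b: "\<And>u. \<bar>\<phi> u\<bar> \<le> D * decay_prod u"
    and d: "\<And>u v. norm v \<le> 1 \<Longrightarrow> \<bar>\<phi> (u + v) - \<phi> u\<bar> \<le> D * norm v * decay_prod u"
    and id: "\<And>\<xi>. norm \<xi> \<le> R \<Longrightarrow> has_bochner_integral lborel (\<lambda>u. of_real (\<phi> u) * cis (2 * pi * (u \<bullet> \<xi>))) 1"
    by (rule reproducing_kernel[OF R]) (rule that)
  have int: "integrable lborel \<phi>"
    using D b by (intro Bochner_Integration.integrable_bound[OF integrable_mult_right[OF integrable_decay_prod, of D]])
      (auto simp: abs_mult)
  define W where "W = integral\<^sup>L lborel (decay_prod :: 'a \<Rightarrow> real)"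
  have W: "W \<ge> 0" unfolding W_def by (rule Bochner_Integration.integral_nonneg) simp
  \<comment> \<open>The summand 1 makes the constant positive from W >= 0 alone.\<close>
  show thesis
  proof (rule that[of "D\<^sup>2 * W + 1"])
    show "D\<^sup>2 * W + 1 > 0" using W by (simp add: add_nonneg_pos)
    fix F f :: "'a \<Rightarrow> complex" assume "bandlimited R F f"
    then interpret bandlimited R F f .
    have rep: "f x = (LINT z|lborel. of_real (\<phi> (x - z)) * f z)" for x
      by (rule f_reproducing[OF int id])
    fix x
    have "ennreal ((cmod (f x))\<^sup>2) \<le> ennreal (D\<^sup>2 * W) * decay_average f x"
      unfolding W_def
      by (subst rep, rule norm_integral_decay_sq_le) (use D b in auto)
    also have "\<dots> \<le> ennreal (D\<^sup>2 * W + 1) * decay_average f x"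
      by (intro mult_right_mono ennreal_leI) auto
    finally show "ennreal ((cmod (f x))\<^sup>2) \<le> ennreal (D\<^sup>2 * W + 1) * decay_average f x" .
    fix y assume xy: "dist x y \<le> 1"
    \<comment> \<open>Needed to write \<open>f y - f x\<close> as a single integral: the kernel is
      integrable and \<open>f\<close> is bounded by the integral of its spectrum.\<close>
    have intf: "integrable lborel (\<lambda>z. of_real (\<phi> (x - z)) * f z)" for x
    proof -
      have "has_bochner_integral lborel (\<lambda>z. \<phi> (x - z)) (integral\<^sup>L lborel \<phi>)"
        using int by (intro has_bochner_integral_minus_left has_bochner_integral_integrable)
      then have "integrable lborel (\<lambda>z. \<phi> (x - z) * (LINT \<xi>|lborel. cmod (F \<xi>)))"
        by (auto simp: has_bochner_integral_iff)
      then show ?thesis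
      proof (rule Bochner_Integration.integrable_bound)
        have "norm (of_real (\<phi> (x - z)) * f z) \<le> norm (\<phi> (x - z) * (LINT \<xi>|lborel. cmod (F \<xi>)))" for z
          unfolding norm_mult norm_of_real real_norm_def abs_mult
          by (intro mult_left_mono order_trans[OF f_bound abs_ge_self]) simp
        then show "AE z in lborel. norm (of_real (\<phi> (x - z)) * f z) \<le> norm (\<phi> (x - z) * (LINT \<xi>|lborel. cmod (F \<xi>)))"
          by (rule AE_I2)
      qed measurable
    qed
    have "f y - f x = (LINT z|lborel. of_real (\<phi> (y - z)) * f z - of_real (\<phi> (x - z)) * f z)"
      by (subst rep[of x], subst rep[of y]) (rule Bochner_Integration.integral_diff[OF intf intf, symmetric])
    then have eq: "f y - f x = (LINT z|lborel. of_real (\<phi> (y - z) - \<phi> (x - z)) * f z)"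
      by (simp add: left_diff_distrib)
    have "ennreal ((cmod (f y - f x))\<^sup>2) \<le> ennreal ((D * dist x y)\<^sup>2 * W) * decay_average f x"
      unfolding W_def eq
    proof (rule norm_integral_decay_sq_le)
      fix z
      show "\<bar>\<phi> (y - z) - \<phi> (x - z)\<bar> \<le> D * dist x y * decay_prod (x - z)"
        using d[of "y - x" "x - z"] xy by (simp add: dist_norm norm_minus_commute)
    qed (use D in auto)
    also have "\<dots> \<le> ennreal ((D\<^sup>2 * W + 1) * (dist x y)\<^sup>2) * decay_average f x"
      by (intro mult_right_mono ennreal_leI) (auto simp: power_mult_distrib algebra_simps)
    finally show "ennreal ((cmod (f y - f x))\<^sup>2) \<le> ennreal ((D\<^sup>2 * W + 1) * (dist x y)\<^sup>2) * decay_average f x" .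
  qed
qed

text \<open>The measure need not live on the Borel sets, so that both \<open>traj_measure \<Gamma>\<close> and
  \<open>count_space \<Lambda>\<close> are covered.\<close>

definition locally_bounded_measure :: "'a::euclidean_space measure \<Rightarrow> bool" where
  "locally_bounded_measure \<nu> \<longleftrightarrow> (\<lambda>x. x) \<in> measurable \<nu> borel \<and>
     (\<exists>\<rho>>0. \<exists>M::real. \<forall>z. emeasure \<nu> (ball z \<rho> \<inter> space \<nu>) \<le> ennreal M)"

lemma locally_bounded_measureI:
  assumes "(\<lambda>x. x) \<in> measurable \<nu> borel" "\<rho> > 0" "\<And>z. emeasure \<nu> (ball z \<rho> \<inter> space \<nu>) \<le> ennreal M"
  shows "locally_bounded_measure \<nu>"
  using assms unfolding locally_bounded_measure_def by blast

lemma locally_bounded_measureD: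
  assumes "locally_bounded_measure \<nu>"
  obtains \<rho> M :: real where "\<rho> > 0" "M > 0"
    "\<And>z r. r \<le> \<rho> \<Longrightarrow> emeasure \<nu> (ball z r \<inter> space \<nu>) \<le> ennreal M"
proof -
  obtain \<rho> M :: real where \<rho>: "\<rho> > 0" and M: "\<And>z. emeasure \<nu> (ball z \<rho> \<inter> space \<nu>) \<le> ennreal M"
    and id: "(\<lambda>x. x) \<in> measurable \<nu> borel"
    using assms unfolding locally_bounded_measure_def by blast
  show thesis
  proof (rule that[of \<rho> "max M 1"])
    fix z r assume "r \<le> \<rho>"
    moreover have "ball z \<rho> \<inter> space \<nu> \<in> sets \<nu>"
      using measurable_sets[OF id, of "ball z \<rho>"] by simp
    ultimately have "emeasure \<nu> (ball z r \<inter> space \<nu>) \<le> emeasure \<nu> (ball z \<rho> \<inter> space \<nu>)"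
      by (intro emeasure_mono) auto
    also have "\<dots> \<le> ennreal M" by (rule M)
    also have "\<dots> \<le> ennreal (max M 1)" by (rule ennreal_leI) simp
    finally show "emeasure \<nu> (ball z r \<inter> space \<nu>) \<le> ennreal (max M 1)" .
  qed (use \<rho> in auto)
qed

text \<open>Balls around a countable dense set cover the space and have finite measure. The
  exchanges of integrals below rest on this; for \<open>count_space\<close> \<Lambda> it amounts to
  countability of \<Lambda>.\<close>

lemma sigma_finite_locally_bounded_measure:
  assumes "locally_bounded_measure \<nu>"
  shows "sigma_finite_measure \<nu>"
proof -
  obtain \<rho> M :: real where \<rho>: "\<rho> > 0" and M: "\<And>z. emeasure \<nu> (ball z \<rho> \<inter> space \<nu>) \<le> ennreal M"
    and id: "(\<lambda>x. x) \<in> measurable \<nu> borel"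
    using assms unfolding locally_bounded_measure_def by blast
  obtain D :: "'a set" where D: "countable D" "\<And>X. open X \<Longrightarrow> X \<noteq> {} \<Longrightarrow> \<exists>d\<in>D. d \<in> X"
    using countable_dense_setE by blast
  show ?thesis
  proof
    show "\<exists>A. countable A \<and> A \<subseteq> sets \<nu> \<and> \<Union>A = space \<nu> \<and> (\<forall>a\<in>A. emeasure \<nu> a \<noteq> \<infinity>)"
    proof (intro exI conjI ballI)
      show "countable ((\<lambda>d. ball d \<rho> \<inter> space \<nu>) ` D)" using D by simp
      show "(\<lambda>d. ball d \<rho> \<inter> space \<nu>) ` D \<subseteq> sets \<nu>"
        using measurable_sets[OF id, of "ball _ \<rho>"] by auto
      show "\<Union>((\<lambda>d. ball d \<rho> \<inter> space \<nu>) ` D) = space \<nu>"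
      proof safe
        fix x assume x: "x \<in> space \<nu>"
        obtain d where "d \<in> D" "d \<in> ball x \<rho>" using D(2)[of "ball x \<rho>"] \<rho> by auto
        then show "x \<in> \<Union>((\<lambda>d. ball d \<rho> \<inter> space \<nu>) ` D)" using x by (auto simp: dist_commute)
      qed
      fix a assume "a \<in> (\<lambda>d. ball d \<rho> \<inter> space \<nu>) ` D"
      then obtain d where "a = ball d \<rho> \<inter> space \<nu>" by blast
      then have "emeasure \<nu> a \<le> ennreal M" using M by simp
      then show "emeasure \<nu> a \<noteq> \<infinity>" by (auto simp: top_unique)
    qed
  qed
qed

text \<open>By Fubini it suffices to bound the \<nu>-integral of the weight uniformly in its centre
  z (\<open>key\<close>). The value at x is compared with an average over a ball of radius \<rho> <=
  1 around x, at the cost of T = 3^d. Exchanging the integrals leaves the \<nu>-masses of balls, at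
  most M, against Lebesgue measure.\<close>

lemma nn_integral_decay_average_le:
  fixes \<nu> :: "'a::euclidean_space measure"
  assumes \<nu>: "locally_bounded_measure \<nu>"
  obtains C :: real where "C > 0" "\<And>f :: 'a \<Rightarrow> complex. f \<in> borel_measurable borel \<Longrightarrow>
    (\<integral>\<^sup>+x. decay_average f x \<partial>\<nu>) \<le> ennreal C * (\<integral>\<^sup>+z. ennreal ((cmod (f z))\<^sup>2) \<partial>lborel)"
proof -
  interpret \<nu>: sigma_finite_measure \<nu> by (rule sigma_finite_locally_bounded_measure[OF \<nu>])
  interpret P: pair_sigma_finite \<nu> "lborel :: 'a measure" ..
  have norm_sq_meas: "(\<lambda>z. ennreal ((cmod (f z))\<^sup>2)) \<in> borel_measurable lborel"
    if "f \<in> borel_measurable borel" for f :: "'a \<Rightarrow> complex"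
    using that by measurable
  have decay_meas: "(\<lambda>y. ennreal (decay_prod (z - y))) \<in> borel_measurable lborel" for z :: 'a
    by measurable
  have [measurable]: "(\<lambda>x. x) \<in> measurable \<nu> borel"
    using \<nu> by (simp add: locally_bounded_measure_def)
  obtain \<rho>' M where \<rho>': "\<rho>' > 0" and M: "M > 0" "\<And>z r. r \<le> \<rho>' \<Longrightarrow> emeasure \<nu> (ball z r \<inter> space \<nu>) \<le> ennreal M"
    using locally_bounded_measureD[OF \<nu>] by metis
  define \<rho> where "\<rho> = min \<rho>' 1"
  have \<rho>: "\<rho> > 0" "\<rho> \<le> 1" "\<rho> \<le> \<rho>'" using \<rho>' by (auto simp: \<rho>_def)
  define V where "V = unit_ball_vol (real DIM('a)) * \<rho> ^ DIM('a)"
  have V: "V > 0" using \<rho> by (simp add: V_def)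
  have vol: "emeasure lborel (ball x \<rho>) = ennreal V" for x :: 'a
    using \<rho> by (simp add: V_def emeasure_ball)
  define W where "W = integral\<^sup>L lborel (decay_prod :: 'a \<Rightarrow> real)"
  have W: "W \<ge> 0" unfolding W_def by (rule Bochner_Integration.integral_nonneg) simp
  define T :: real where "T = 3 ^ DIM('a)"
  have T: "T > 0" by (simp add: T_def)
  have [measurable]: "(\<lambda>(x, y). indicator (ball x \<rho>) y :: ennreal) \<in> borel_measurable (\<nu> \<Otimes>\<^sub>M lborel)"
  proof -
    have eq: "(\<lambda>(x, y). indicator (ball x \<rho>) y :: ennreal) = (\<lambda>p. if dist (fst p) (snd p) < \<rho> then 1 else 0)"
      by (auto simp: indicator_def fun_eq_iff)
    show ?thesis unfolding eq by measurable
  qed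
  have key: "(\<integral>\<^sup>+x. ennreal (decay_prod (x - z)) \<partial>\<nu>) \<le> ennreal (T * M * W / V)" for z
  proof -
    have "ennreal V * (\<integral>\<^sup>+x. ennreal (decay_prod (x - z)) \<partial>\<nu>) = (\<integral>\<^sup>+x. ennreal V * ennreal (decay_prod (x - z)) \<partial>\<nu>)"
      by (rule nn_integral_cmult[symmetric]) measurable
    also have "\<dots> = (\<integral>\<^sup>+x. \<integral>\<^sup>+y. ennreal (decay_prod (x - z)) * indicator (ball x \<rho>) y \<partial>lborel \<partial>\<nu>)"
      by (intro nn_integral_cong) (simp add: nn_integral_cmult_indicator vol mult.commute)
    also have "\<dots> \<le> (\<integral>\<^sup>+x. \<integral>\<^sup>+y. ennreal (T * decay_prod (y - z)) * indicator (ball x \<rho>) y \<partial>lborel \<partial>\<nu>)"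
    proof (intro nn_integral_mono)
      fix x y :: 'a
      have "decay_prod (x - z) \<le> T * decay_prod (y - z)" if "y \<in> ball x \<rho>"
        using decay_prod_shift_le[of "x - y" "y - z"] that \<rho> by (simp add: T_def dist_norm)
      then show "ennreal (decay_prod (x - z)) * indicator (ball x \<rho>) y \<le> ennreal (T * decay_prod (y - z)) * indicator (ball x \<rho>) y"
        by (auto simp: indicator_def intro!: ennreal_leI)
    qed
    also have "\<dots> = (\<integral>\<^sup>+y. \<integral>\<^sup>+x. ennreal (T * decay_prod (y - z)) * indicator (ball x \<rho>) y \<partial>\<nu> \<partial>lborel)"
      by (rule P.Fubini'[symmetric]) measurable
    also have "\<dots> = (\<integral>\<^sup>+y. \<integral>\<^sup>+x. ennreal (T * decay_prod (y - z)) * indicator (ball y \<rho> \<inter> space \<nu>) x \<partial>\<nu> \<partial>lborel)"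
      by (intro nn_integral_cong) (auto simp: indicator_def dist_commute)
    also have "\<dots> = (\<integral>\<^sup>+y. ennreal (T * decay_prod (y - z)) * emeasure \<nu> (ball y \<rho> \<inter> space \<nu>) \<partial>lborel)"
    proof (intro nn_integral_cong nn_integral_cmult_indicator)
      fix y :: 'a
      show "ball y \<rho> \<inter> space \<nu> \<in> sets \<nu>"
        using measurable_sets[of "\<lambda>x. x" \<nu> borel "ball y \<rho>"] by simp
    qed
    also have "\<dots> \<le> (\<integral>\<^sup>+y. ennreal (T * decay_prod (y - z)) * ennreal M \<partial>lborel)"
      using M(2) \<rho> by (intro nn_integral_mono mult_left_mono) auto
    also have "\<dots> = (\<integral>\<^sup>+y. ennreal (T * M) * ennreal (decay_prod (z - y)) \<partial>lborel)"
    proof (rule nn_integral_cong)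
      fix y
      have "decay_prod (y - z) = decay_prod (z - y)"
        using decay_prod_minus[of "z - y"] by simp
      then show "ennreal (T * decay_prod (y - z)) * ennreal M = ennreal (T * M) * ennreal (decay_prod (z - y))"
        using T M(1) by (simp add: ennreal_mult[symmetric] mult_ac)
    qed
    also have "\<dots> = ennreal (T * M) * (\<integral>\<^sup>+y. ennreal (decay_prod (z - y)) \<partial>lborel)"
      by (rule nn_integral_cmult[OF decay_meas])
    also have "(\<integral>\<^sup>+y. ennreal (decay_prod (z - y)) \<partial>lborel) = ennreal W"
      unfolding W_def by (rule nn_integral_decay_prod)
    finally have le: "ennreal V * (\<integral>\<^sup>+x. ennreal (decay_prod (x - z)) \<partial>\<nu>) \<le> ennreal (T * M * W)"
      using T M W by (simp add: ennreal_mult)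
    have "(\<integral>\<^sup>+x. ennreal (decay_prod (x - z)) \<partial>\<nu>) = ennreal (1 / V) * (ennreal V * (\<integral>\<^sup>+x. ennreal (decay_prod (x - z)) \<partial>\<nu>))"
      using V by (simp add: mult.assoc[symmetric] ennreal_mult[symmetric])
    also have "\<dots> \<le> ennreal (1 / V) * ennreal (T * M * W)"
      by (intro mult_left_mono le) simp
    also have "\<dots> = ennreal (T * M * W / V)"
      using V T M W by (simp add: ennreal_mult[symmetric])
    finally show ?thesis .
  qed
  show thesis
  proof (rule that[of "T * M * W / V + 1"])
    show "T * M * W / V + 1 > 0" using T M W V by (intro add_nonneg_pos) auto
    fix f :: "'a \<Rightarrow> complex" assume f [measurable]: "f \<in> borel_measurable borel"
    have "(\<integral>\<^sup>+x. decay_average f x \<partial>\<nu>)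
       = (\<integral>\<^sup>+z. \<integral>\<^sup>+x. ennreal ((cmod (f z))\<^sup>2) * ennreal (decay_prod (x - z)) \<partial>\<nu> \<partial>lborel)"
      unfolding decay_average_def by (rule P.Fubini'[symmetric]) measurable
    also have "\<dots> = (\<integral>\<^sup>+z. ennreal ((cmod (f z))\<^sup>2) * (\<integral>\<^sup>+x. ennreal (decay_prod (x - z)) \<partial>\<nu>) \<partial>lborel)"
      by (intro nn_integral_cong nn_integral_cmult) measurable
    also have "\<dots> \<le> (\<integral>\<^sup>+z. ennreal ((cmod (f z))\<^sup>2) * ennreal (T * M * W / V) \<partial>lborel)"
      by (intro nn_integral_mono mult_left_mono key) auto
    also have "\<dots> = (\<integral>\<^sup>+z. ennreal ((cmod (f z))\<^sup>2) \<partial>lborel) * ennreal (T * M * W / V)"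
      by (rule nn_integral_multc[OF norm_sq_meas[OF f]])
    also have "\<dots> \<le> (\<integral>\<^sup>+z. ennreal ((cmod (f z))\<^sup>2) \<partial>lborel) * ennreal (T * M * W / V + 1)"
      by (intro mult_left_mono ennreal_leI) auto
    finally show "(\<integral>\<^sup>+x. decay_average f x \<partial>\<nu>) \<le> ennreal (T * M * W / V + 1) * (\<integral>\<^sup>+z. ennreal ((cmod (f z))\<^sup>2) \<partial>lborel)"
      by (simp add: mult.commute)
  qed
qed

text \<open>For dist x y < r one has |f x|^2 <= 2 |f y|^2 + 2 E x. Integrating y over the ball
  around x against \<mu> produces c on the left; integrating x against \<nu> and exchanging the
  order produces the \<nu>-mass of a ball, at most M, on the right.\<close>

lemma nn_integral_local_compare:
  fixes \<nu> \<mu> :: "'a::euclidean_space measure" and f :: "'a \<Rightarrow> complex"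
  assumes \<nu>: "locally_bounded_measure \<nu>" and \<mu>: "locally_bounded_measure \<mu>"
    and [measurable]: "f \<in> borel_measurable borel" "E \<in> borel_measurable borel"
    and osc: "\<And>x y. dist x y < r \<Longrightarrow> ennreal ((cmod (f y - f x))\<^sup>2) \<le> E x"
    and M: "\<And>z. emeasure \<nu> (ball z r \<inter> space \<nu>) \<le> ennreal M"
    and c: "AE x in \<nu>. ennreal c \<le> emeasure \<mu> (ball x r \<inter> space \<mu>)"
  shows "ennreal c * (\<integral>\<^sup>+x. ennreal ((cmod (f x))\<^sup>2) \<partial>\<nu>)
    \<le> 2 * ennreal M * (\<integral>\<^sup>+y. ennreal ((cmod (f y))\<^sup>2) \<partial>\<mu>) + ennreal c * (2 * (\<integral>\<^sup>+x. E x \<partial>\<nu>))"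
proof -
  interpret \<nu>: sigma_finite_measure \<nu> by (rule sigma_finite_locally_bounded_measure[OF \<nu>])
  interpret \<mu>: sigma_finite_measure \<mu> by (rule sigma_finite_locally_bounded_measure[OF \<mu>])
  interpret P: pair_sigma_finite \<nu> \<mu> ..
  have [measurable]: "(\<lambda>x. x) \<in> measurable \<nu> borel" "(\<lambda>x. x) \<in> measurable \<mu> borel"
    using \<nu> \<mu> by (simp_all add: locally_bounded_measure_def)
  have ball\<nu>: "ball y r \<inter> space \<nu> \<in> sets \<nu>" and ball\<mu>: "ball y r \<inter> space \<mu> \<in> sets \<mu>" for y
    using measurable_sets[of "\<lambda>x. x" \<nu> borel "ball y r"] measurable_sets[of "\<lambda>x. x" \<mu> borel "ball y r"]
    by simp_all
  let ?a = "\<lambda>x. ennreal ((cmod (f x))\<^sup>2)"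
  let ?I = "\<lambda>x y. if dist x y < r then 1 else 0 :: ennreal"
  have [measurable]: "?a \<in> borel_measurable \<nu>" "?a \<in> borel_measurable \<mu>" "E \<in> borel_measurable \<nu>"
    by measurable
  have pointwise: "ennreal c * ?a x \<le> (\<integral>\<^sup>+y. 2 * (?I x y * ?a y) \<partial>\<mu>) + ennreal c * (2 * E x)"
    if cx: "ennreal c \<le> emeasure \<mu> (ball x r \<inter> space \<mu>)" for x
  \<comment> \<open>Subtraction in \<open>ennreal\<close> is truncated. The case split ensures that
    \<open>?a x - 2 * E x\<close> is a genuine difference, to which \<open>2 * E x\<close> can be
    added back.\<close>
  proof (cases "?a x \<le> 2 * E x")
    case True
    then have "ennreal c * ?a x \<le> ennreal c * (2 * E x)" by (intro mult_left_mono) auto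
    then show ?thesis by (simp add: add_increasing)
  next
    case False
    have step: "?a x - 2 * E x \<le> 2 * ?a y" if "dist x y < r" for y
    proof -
      have "(cmod (f x))\<^sup>2 \<le> 2 * (cmod (f y))\<^sup>2 + 2 * (cmod (f y - f x))\<^sup>2"
      proof -
        have "cmod (f x) \<le> cmod (f y) + cmod (f y - f x)"
          using norm_triangle_ineq4[of "f y" "f y - f x"] by simp
        then have "(cmod (f x))\<^sup>2 \<le> (cmod (f y) + cmod (f y - f x))\<^sup>2"
          by (intro power_mono) auto
        also have "\<dots> \<le> 2 * (cmod (f y))\<^sup>2 + 2 * (cmod (f y - f x))\<^sup>2"
          using zero_le_power2[of "cmod (f y) - cmod (f y - f x)"] by (simp add: power2_eq_square algebra_simps)
        finally show ?thesis .
      qed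
      then have "?a x \<le> 2 * ?a y + 2 * ennreal ((cmod (f y - f x))\<^sup>2)"
        by (subst (1 2) ennreal_numeral[symmetric]) (simp add: ennreal_mult[symmetric] ennreal_plus[symmetric] ennreal_leI del: ennreal_plus ennreal_numeral)
      also have "\<dots> \<le> 2 * ?a y + 2 * E x"
        using osc[OF that] by (intro add_left_mono mult_left_mono) auto
      finally show ?thesis
        by (simp add: ennreal_minus_le_iff add.commute)
    qed
    have "ennreal c * (?a x - 2 * E x) \<le> (?a x - 2 * E x) * emeasure \<mu> (ball x r \<inter> space \<mu>)"
      using cx by (subst mult.commute) (intro mult_left_mono, auto)
    also have "\<dots> = (\<integral>\<^sup>+y. (?a x - 2 * E x) * indicator (ball x r \<inter> space \<mu>) y \<partial>\<mu>)"
      by (rule nn_integral_cmult_indicator[OF ball\<mu>, symmetric])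
    also have "\<dots> \<le> (\<integral>\<^sup>+y. 2 * (?I x y * ?a y) \<partial>\<mu>)"
      by (intro nn_integral_mono) (auto simp: indicator_def step)
    finally have "ennreal c * (?a x - 2 * E x) + ennreal c * (2 * E x) \<le> (\<integral>\<^sup>+y. 2 * (?I x y * ?a y) \<partial>\<mu>) + ennreal c * (2 * E x)"
      by (rule add_right_mono)
    moreover have "(?a x - 2 * E x) + 2 * E x = ?a x"
      using False by (intro diff_add_cancel_ennreal) auto
    ultimately show ?thesis by (simp only: distrib_left[symmetric])
  qed
  have "ennreal c * (\<integral>\<^sup>+x. ?a x \<partial>\<nu>) = (\<integral>\<^sup>+x. ennreal c * ?a x \<partial>\<nu>)"
    by (rule nn_integral_cmult[symmetric]) measurable
  also have "\<dots> \<le> (\<integral>\<^sup>+x. (\<integral>\<^sup>+y. 2 * (?I x y * ?a y) \<partial>\<mu>) + ennreal c * (2 * E x) \<partial>\<nu>)"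
    using c by (intro nn_integral_mono_AE) (auto elim!: eventually_mono intro: pointwise)
  also have "\<dots> = (\<integral>\<^sup>+x. \<integral>\<^sup>+y. 2 * (?I x y * ?a y) \<partial>\<mu> \<partial>\<nu>) + (\<integral>\<^sup>+x. ennreal c * (2 * E x) \<partial>\<nu>)"
    by (rule nn_integral_add) measurable
  also have "(\<integral>\<^sup>+x. ennreal c * (2 * E x) \<partial>\<nu>) = ennreal c * (2 * (\<integral>\<^sup>+x. E x \<partial>\<nu>))"
    by (simp add: nn_integral_cmult)
  also have "(\<integral>\<^sup>+x. \<integral>\<^sup>+y. 2 * (?I x y * ?a y) \<partial>\<mu> \<partial>\<nu>) = (\<integral>\<^sup>+y. \<integral>\<^sup>+x. 2 * (?I x y * ?a y) \<partial>\<nu> \<partial>\<mu>)"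
    by (rule P.Fubini'[symmetric]) measurable
  also have "\<dots> = (\<integral>\<^sup>+y. \<integral>\<^sup>+x. (2 * ?a y) * indicator (ball y r \<inter> space \<nu>) x \<partial>\<nu> \<partial>\<mu>)"
    by (intro nn_integral_cong) (auto simp: indicator_def dist_commute)
  also have "\<dots> = (\<integral>\<^sup>+y. (2 * ?a y) * emeasure \<nu> (ball y r \<inter> space \<nu>) \<partial>\<mu>)"
    by (intro nn_integral_cong nn_integral_cmult_indicator ball\<nu>)
  also have "\<dots> \<le> (\<integral>\<^sup>+y. (2 * ?a y) * ennreal M \<partial>\<mu>)"
    by (intro nn_integral_mono mult_left_mono M) auto
  also have "\<dots> = (\<integral>\<^sup>+y. (2 * ennreal M) * ?a y \<partial>\<mu>)"
    by (simp add: mult_ac)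
  also have "\<dots> = 2 * ennreal M * (\<integral>\<^sup>+y. ?a y \<partial>\<mu>)"
    by (rule nn_integral_cmult) measurable
  finally show ?thesis by (simp add: add_right_mono)
qed

section \<open>Transfer of sampling inequalities\<close>

text \<open>The common form of the two notions of sampling, a sum over \<Lambda> being an integral
  against counting measure; one transfer lemma then serves both directions.\<close>

definition sampling_measure :: "'a::euclidean_space set \<Rightarrow> 'a measure \<Rightarrow> bool" where
  "sampling_measure \<Omega> \<nu> \<longleftrightarrow>
     (\<exists>A B :: real. A > 0 \<and> B > 0 \<and>
       (\<forall>f\<in>PW2 \<Omega>.
          ennreal A * L2_norm_sq f \<le> (\<integral>\<^sup>+x. ennreal ((cmod (f x))\<^sup>2) \<partial>\<nu>) \<and>
          (\<integral>\<^sup>+x. ennreal ((cmod (f x))\<^sup>2) \<partial>\<nu>) \<le> ennreal B * L2_norm_sq f))"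

lemma sampling_trajectory_eq: "sampling_trajectory \<Omega> \<Gamma> \<longleftrightarrow> sampling_measure \<Omega> (traj_measure \<Gamma>)"
  unfolding sampling_trajectory_def sampling_measure_def ..

lemma sampling_set_eq: "sampling_set \<Omega> \<Lambda> \<longleftrightarrow> sampling_measure \<Omega> (count_space \<Lambda>)"
  unfolding sampling_set_def sampling_measure_def ..

lemma L2_norm_sq_lborel: "L2_norm_sq f = (\<integral>\<^sup>+x. ennreal ((cmod (f x))\<^sup>2) \<partial>lborel)"
  unfolding L2_norm_sq_def by (rule nn_integral_completion)

section \<open>Uniform estimates on the Paley-Wiener space\<close>

lemma PW2_bandlimited:
  assumes "bounded \<Omega>"
  obtains R :: real where "R > 0" "\<And>f. f \<in> PW2 \<Omega> \<Longrightarrow> \<exists>F. bandlimited R F f"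
proof -
  obtain R where R: "R > 0" "\<Omega> \<subseteq> cball 0 R"
    using assms unfolding bounded_pos by (auto simp: subset_iff)
  show thesis
  proof (rule that[OF R(1)])
    fix f assume "f \<in> PW2 \<Omega>"
    then obtain F where "band_spectrum R F" "f = fourier_lborel F"
      using PW2_band_spectrum[OF _ R(2)] by metis
    then show "\<exists>F. bandlimited R F f" by (auto simp: bandlimited_def)
  qed
qed

lemma PW2_bounds:
  fixes \<Omega> :: "'a::euclidean_space set"
  assumes "bounded \<Omega>"
  obtains C :: real where "C > 0"
    "\<And>f. f \<in> PW2 \<Omega> \<Longrightarrow> f \<in> borel_measurable borel"
    "\<And>f. f \<in> PW2 \<Omega> \<Longrightarrow> L2_norm_sq f < \<infinity>"
    "\<And>f x. f \<in> PW2 \<Omega> \<Longrightarrow> ennreal ((cmod (f x))\<^sup>2) \<le> ennreal C * decay_average f x"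
    "\<And>f x y. f \<in> PW2 \<Omega> \<Longrightarrow> dist x y \<le> 1 \<Longrightarrow>
      ennreal ((cmod (f y - f x))\<^sup>2) \<le> ennreal (C * (dist x y)\<^sup>2) * decay_average f x"
proof -
  obtain R where R: "R > 0" "\<And>f. f \<in> PW2 \<Omega> \<Longrightarrow> \<exists>F. bandlimited R F f"
    by (rule PW2_bandlimited[OF assms]) (rule that)
  obtain C where C: "C > 0"
    "\<And>(F :: 'a \<Rightarrow> complex) f x. bandlimited R F f \<Longrightarrow>
      ennreal ((cmod (f x))\<^sup>2) \<le> ennreal C * decay_average f x"
    "\<And>(F :: 'a \<Rightarrow> complex) f x y. bandlimited R F f \<Longrightarrow> dist x y \<le> 1 \<Longrightarrow>
      ennreal ((cmod (f y - f x))\<^sup>2) \<le> ennreal (C * (dist x y)\<^sup>2) * decay_average f x"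
    by (rule bandlimited_local_bounds[OF R(1)]) (rule that)
  show thesis
  proof (rule that[OF C(1)])
    fix f assume "f \<in> PW2 \<Omega>"
    then obtain F where F: "bandlimited R F f" using R(2) by blast
    show "f \<in> borel_measurable borel" by (rule bandlimited.borel_measurable_f[OF F])
    show "L2_norm_sq f < \<infinity>" unfolding L2_norm_sq_lborel by (rule bandlimited.L2_norm_finite[OF F])
    show "ennreal ((cmod (f x))\<^sup>2) \<le> ennreal C * decay_average f x" for x
      by (rule C(2)[OF F])
    show "dist x y \<le> 1 \<Longrightarrow> ennreal ((cmod (f y - f x))\<^sup>2) \<le> ennreal (C * (dist x y)\<^sup>2) * decay_average f x" for x y
      by (rule C(3)[OF F])
  qed
qed

text \<open>The pointwise bound by \<open>decay_average\<close> is integrated against \<nu>. Local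
  boundedness alone thus gives the upper sampling inequality, for the target measure of a transfer
  too.\<close>

lemma Bessel_bound:
  assumes \<Omega>: "bounded \<Omega>" and \<nu>: "locally_bounded_measure \<nu>"
  obtains B :: real where "B > 0"
    "\<And>f. f \<in> PW2 \<Omega> \<Longrightarrow> (\<integral>\<^sup>+x. ennreal ((cmod (f x))\<^sup>2) \<partial>\<nu>) \<le> ennreal B * L2_norm_sq f"
proof -
  have id: "(\<lambda>x. x) \<in> measurable \<nu> borel" using \<nu> by (simp add: locally_bounded_measure_def)
  obtain C where C: "C > 0" "\<And>f. f \<in> PW2 \<Omega> \<Longrightarrow> f \<in> borel_measurable borel"
    "\<And>f x. f \<in> PW2 \<Omega> \<Longrightarrow> ennreal ((cmod (f x))\<^sup>2) \<le> ennreal C * decay_average f x"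
    by (rule PW2_bounds[OF \<Omega>]) (rule that)
  obtain C' where C': "C' > 0" "\<And>f. f \<in> borel_measurable borel \<Longrightarrow>
    (\<integral>\<^sup>+x. decay_average f x \<partial>\<nu>) \<le> ennreal C' * (\<integral>\<^sup>+z. ennreal ((cmod (f z))\<^sup>2) \<partial>lborel)"
    by (rule nn_integral_decay_average_le[OF \<nu>]) (rule that)
  show thesis
  proof (rule that[of "C * C'"])
    show "C * C' > 0" using C C' by simp
    fix f assume f: "f \<in> PW2 \<Omega>"
    have "(\<lambda>x. decay_average f x) \<in> borel_measurable \<nu>"
      using measurable_compose[OF id borel_measurable_decay_average[OF C(2)[OF f]]] .
    then have "(\<integral>\<^sup>+x. ennreal C * decay_average f x \<partial>\<nu>) = ennreal C * (\<integral>\<^sup>+x. decay_average f x \<partial>\<nu>)"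
      by (rule nn_integral_cmult)
    moreover have "(\<integral>\<^sup>+x. ennreal ((cmod (f x))\<^sup>2) \<partial>\<nu>) \<le> (\<integral>\<^sup>+x. ennreal C * decay_average f x \<partial>\<nu>)"
      by (intro nn_integral_mono C(3)[OF f])
    moreover have "ennreal C * (\<integral>\<^sup>+x. decay_average f x \<partial>\<nu>) \<le> ennreal C * (ennreal C' * L2_norm_sq f)"
      unfolding L2_norm_sq_lborel by (intro mult_left_mono C'(2) C(2)[OF f]) simp
    ultimately show "(\<integral>\<^sup>+x. ennreal ((cmod (f x))\<^sup>2) \<partial>\<nu>) \<le> ennreal (C * C') * L2_norm_sq f"
      using C(1) C'(1) by (simp add: ennreal_mult mult.assoc)
  qed
qed

text \<open>Both directions of the theorem are instances: \<open>\<nu>\<close> and \<open>\<mu>\<close> are \<open>traj_measure \<Gamma>\<close> and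
  \<open>count_space \<Lambda>\<close>, in either order.\<close>

lemma sampling_measure_transfer:
  fixes \<Omega> :: "'a::euclidean_space set"
  assumes \<Omega>: "bounded \<Omega>" and \<nu>: "locally_bounded_measure \<nu>" and samp: "sampling_measure \<Omega> \<nu>"
  obtains r0 :: real where "r0 > 0"
    "\<And>r c \<mu>. 0 < r \<Longrightarrow> r \<le> r0 \<Longrightarrow> 0 < c \<Longrightarrow> locally_bounded_measure \<mu> \<Longrightarrow>
      (AE x in \<nu>. ennreal c \<le> emeasure \<mu> (ball x r \<inter> space \<mu>)) \<Longrightarrow> sampling_measure \<Omega> \<mu>"
proof -
  have id: "(\<lambda>x. x) \<in> measurable \<nu> borel" using \<nu> by (simp add: locally_bounded_measure_def)
  obtain A B :: real where A: "A > 0"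
    "\<And>f. f \<in> PW2 \<Omega> \<Longrightarrow> ennreal A * L2_norm_sq f \<le> (\<integral>\<^sup>+x. ennreal ((cmod (f x))\<^sup>2) \<partial>\<nu>)"
    using samp unfolding sampling_measure_def by blast
  obtain C where C: "C > 0" "\<And>f. f \<in> PW2 \<Omega> \<Longrightarrow> f \<in> borel_measurable borel"
    "\<And>f. f \<in> PW2 \<Omega> \<Longrightarrow> L2_norm_sq f < \<infinity>"
    "\<And>f x y. f \<in> PW2 \<Omega> \<Longrightarrow> dist x y \<le> 1 \<Longrightarrow>
      ennreal ((cmod (f y - f x))\<^sup>2) \<le> ennreal (C * (dist x y)\<^sup>2) * decay_average f x"
    by (rule PW2_bounds[OF \<Omega>]) (rule that)
  obtain K where K: "K > 0" "\<And>f. f \<in> borel_measurable borel \<Longrightarrow>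
    (\<integral>\<^sup>+x. decay_average f x \<partial>\<nu>) \<le> ennreal K * (\<integral>\<^sup>+z. ennreal ((cmod (f z))\<^sup>2) \<partial>lborel)"
    by (rule nn_integral_decay_average_le[OF \<nu>]) (rule that)
  obtain \<rho> M where \<rho>: "\<rho> > 0" "M > 0" "\<And>z r. r \<le> \<rho> \<Longrightarrow> emeasure \<nu> (ball z r \<inter> space \<nu>) \<le> ennreal M"
    by (rule locally_bounded_measureD[OF \<nu>]) (rule that)
  \<comment> \<open>The third bound makes the error \<open>2 * C * r^2 * K\<close> at most A / 2,
    using r^2 <= r from r <= 1. Nothing here depends on \<open>c\<close> or on the target
    measure.\<close>
  define r0 where "r0 = min (min 1 \<rho>) (A / (4 * C * K))"
  have r0: "r0 > 0" "r0 \<le> 1" "r0 \<le> \<rho>" "r0 \<le> A / (4 * C * K)"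
    using A C K \<rho> by (auto simp: r0_def)
  show thesis
  proof (rule that[OF r0(1)])
    fix r c :: real and \<mu> :: "'a measure"
    assume r: "0 < r" "r \<le> r0" and c: "0 < c" and \<mu>: "locally_bounded_measure \<mu>"
      and cover: "AE x in \<nu>. ennreal c \<le> emeasure \<mu> (ball x r \<inter> space \<mu>)"
    obtain B' where B': "B' > 0"
      "\<And>f. f \<in> PW2 \<Omega> \<Longrightarrow> (\<integral>\<^sup>+x. ennreal ((cmod (f x))\<^sup>2) \<partial>\<mu>) \<le> ennreal B' * L2_norm_sq f"
      by (rule Bessel_bound[OF \<Omega> \<mu>]) (rule that)
    have r1: "r \<le> 1" "r \<le> \<rho>" using r r0 by auto
    have small: "2 * C * r\<^sup>2 * K \<le> A / 2"
    proof -
      have "r\<^sup>2 \<le> r * 1" unfolding power2_eq_square using r r1 by (intro mult_left_mono) auto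
      also have "\<dots> \<le> A / (4 * C * K)" using r r0 by auto
      finally show ?thesis using C K by (simp add: field_simps)
    qed
    have lower: "ennreal (c * A / (4 * M)) * L2_norm_sq f \<le> (\<integral>\<^sup>+x. ennreal ((cmod (f x))\<^sup>2) \<partial>\<mu>)"
      if f: "f \<in> PW2 \<Omega>" for f
    proof -
      let ?E = "\<lambda>x. ennreal (C * r\<^sup>2) * decay_average f x"
      have fm: "f \<in> borel_measurable borel" by (rule C(2)[OF f])
      have gm: "decay_average f \<in> borel_measurable borel"
        by (rule borel_measurable_decay_average[OF fm])
      have osc: "ennreal ((cmod (f y - f x))\<^sup>2) \<le> ?E x" if "dist x y < r" for x y
      proof -
        have "ennreal ((cmod (f y - f x))\<^sup>2) \<le> ennreal (C * (dist x y)\<^sup>2) * decay_average f x"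
          using that r1 by (intro C(4)[OF f]) auto
        also have "\<dots> \<le> ?E x"
          using that C(1) by (intro mult_right_mono ennreal_leI mult_left_mono power_mono) auto
        finally show ?thesis .
      qed
      obtain n where n: "L2_norm_sq f = ennreal n" "n \<ge> 0"
        using C(3)[OF f] by (cases "L2_norm_sq f") auto
      have "(\<integral>\<^sup>+x. ?E x \<partial>\<nu>) = ennreal (C * r\<^sup>2) * (\<integral>\<^sup>+x. decay_average f x \<partial>\<nu>)"
        using measurable_compose[OF id gm] by (rule nn_integral_cmult)
      also have "\<dots> \<le> ennreal (C * r\<^sup>2) * (ennreal K * L2_norm_sq f)"
        unfolding L2_norm_sq_lborel by (intro mult_left_mono K(2) fm) simp
      finally have "2 * (\<integral>\<^sup>+x. ?E x \<partial>\<nu>) \<le> 2 * (ennreal (C * r\<^sup>2) * (ennreal K * L2_norm_sq f))"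
        by (rule mult_left_mono) simp
      also have "\<dots> = ennreal (2 * C * r\<^sup>2 * K * n)"
        using C(1) K(1) n by (subst ennreal_numeral[symmetric])
          (simp add: n(1) ennreal_mult[symmetric] mult_ac del: ennreal_numeral)
      also have "\<dots> \<le> ennreal (A / 2 * n)"
        using small n(2) by (intro ennreal_leI mult_right_mono)
      finally have E: "2 * (\<integral>\<^sup>+x. ?E x \<partial>\<nu>) \<le> ennreal (A / 2 * n)" .
      have "ennreal (c * A * n) = ennreal c * (ennreal A * L2_norm_sq f)"
        using c A(1) n by (simp add: n(1) ennreal_mult[symmetric] mult_ac)
      also have "\<dots> \<le> ennreal c * (\<integral>\<^sup>+x. ennreal ((cmod (f x))\<^sup>2) \<partial>\<nu>)"
        by (intro mult_left_mono A(2) f) simp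
      also have "\<dots> \<le> 2 * ennreal M * (\<integral>\<^sup>+y. ennreal ((cmod (f y))\<^sup>2) \<partial>\<mu>) + ennreal c * (2 * (\<integral>\<^sup>+x. ?E x \<partial>\<nu>))"
        by (rule nn_integral_local_compare[OF \<nu> \<mu> fm _ osc \<rho>(3)[OF r1(2)] cover]) (use gm in measurable)
      also have "\<dots> \<le> 2 * ennreal M * (\<integral>\<^sup>+y. ennreal ((cmod (f y))\<^sup>2) \<partial>\<mu>) + ennreal c * ennreal (A / 2 * n)"
        by (intro add_left_mono mult_left_mono E) simp
      finally have main: "ennreal (c * A * n) \<le> 2 * ennreal M * (\<integral>\<^sup>+y. ennreal ((cmod (f y))\<^sup>2) \<partial>\<mu>) + ennreal c * ennreal (A / 2 * n)" .
      \<comment> \<open>An infinite integral over \<mu> makes the claim trivial. Otherwise all terms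
        are finite reals, and cancelling c A n / 2 from c A n <= 2 M m + c A n / 2 gives the
        constant c A / (4 M).\<close>
      show ?thesis
      proof (cases "\<integral>\<^sup>+y. ennreal ((cmod (f y))\<^sup>2) \<partial>\<mu>")
        case (real m)
        have "2 * ennreal M * ennreal m + ennreal c * ennreal (A / 2 * n) = ennreal (2 * M * m + c * (A / 2 * n))"
          using \<rho>(2) real c A(1) n by (subst ennreal_numeral[symmetric])
            (simp add: ennreal_mult[symmetric] ennreal_plus[symmetric] del: ennreal_numeral ennreal_plus)
        with main have "ennreal (c * A * n) \<le> ennreal (2 * M * m + c * (A / 2 * n))"
          by (simp only: real)
        then have "c * A * n \<le> 2 * M * m + c * (A / 2 * n)"
          using \<rho>(2) real c A(1) n by (subst (asm) ennreal_le_iff) auto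
        then have "c * A / (4 * M) * n \<le> m"
          using \<rho>(2) by (simp add: field_simps)
        then show ?thesis
          using real n c A(1) \<rho>(2) by (simp add: ennreal_mult[symmetric] ennreal_leI)
      qed simp
    qed
    show "sampling_measure \<Omega> \<mu>"
      unfolding sampling_measure_def
      by (intro exI[of _ "c * A / (4 * M)"] exI[of _ B'] conjI ballI lower B') (use c A(1) \<rho>(2) in auto)
  qed
qed

section \<open>Trajectories and separated sets\<close>

lemma traj_measure_locally_bounded:
  fixes \<Gamma> :: "'a::euclidean_space set"
  assumes "regular_set \<Gamma>"
  shows "locally_bounded_measure (traj_measure \<Gamma>)"
proof -
  obtain r0 where r0: "r0 > 0" "(SUP x. emeasure (traj_measure \<Gamma>) (ball x r0)) < \<infinity>"
    using assms unfolding regular_set_def by blast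
  have id: "(\<lambda>x. x) \<in> measurable (traj_measure \<Gamma>) borel" by measurable
  obtain M where M: "(SUP x. emeasure (traj_measure \<Gamma>) (ball x r0)) = ennreal M"
    using r0(2) by (cases "SUP x. emeasure (traj_measure \<Gamma>) (ball x r0)") auto
  have "emeasure (traj_measure \<Gamma>) (ball z r0 \<inter> space (traj_measure \<Gamma>)) \<le> ennreal M" for z
    unfolding M[symmetric] by (simp only: space_traj_measure Int_UNIV_right) (rule SUP_upper, simp)
  then show ?thesis
    by (rule locally_bounded_measureI[OF id r0(1)])
qed

lemma count_space_locally_bounded:
  fixes \<Lambda> :: "'a::euclidean_space set"
  assumes r: "r > 0" and sep: "\<And>x y. x \<in> \<Lambda> \<Longrightarrow> y \<in> \<Lambda> \<Longrightarrow> x \<noteq> y \<Longrightarrow> r \<le> dist x y"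
  shows "locally_bounded_measure (count_space \<Lambda>)"
proof -
  have "emeasure (count_space \<Lambda>) (ball z (r / 2) \<inter> \<Lambda>) \<le> ennreal 1" for z
  proof -
    have "x = y" if "x \<in> ball z (r / 2) \<inter> \<Lambda>" "y \<in> ball z (r / 2) \<inter> \<Lambda>" for x y
    proof (rule ccontr)
      assume "x \<noteq> y"
      then have "r \<le> dist x y" using sep that by auto
      moreover have "dist x y \<le> dist z x + dist z y" by (rule dist_triangle3)
      ultimately show False using that by auto
    qed
    then have "ball z (r / 2) \<inter> \<Lambda> = {} \<or> (\<exists>x. ball z (r / 2) \<inter> \<Lambda> = {x})" by blast
    then show ?thesis by (auto simp: emeasure_count_space)
  qed
  then show ?thesis
    using r by (intro locally_bounded_measureI[of _ "r / 2" 1]) auto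
qed

text \<open>Translation multiplies the spectrum by a unimodular factor, which preserves its modulus
  and the set where it vanishes.\<close>

lemma PW2_translate:
  fixes \<Omega> :: "'a::euclidean_space set"
  assumes "f \<in> PW2 \<Omega>"
  shows "(\<lambda>x. f (x - z)) \<in> PW2 \<Omega>"
proof -
  obtain F where F: "F \<in> borel_measurable lebesgue" "integrable lebesgue (\<lambda>\<xi>. (cmod (F \<xi>))\<^sup>2)"
    "AE \<xi> in lebesgue. \<xi> \<notin> \<Omega> \<longrightarrow> F \<xi> = 0" and f: "f = fourier_transform F"
    using assms unfolding PW2_def by auto
  let ?G = "\<lambda>\<xi>. cis (2 * pi * (z \<bullet> \<xi>)) * F \<xi>"
  have "?G \<in> borel_measurable lebesgue"
    by (rule borel_measurable_times[OF measurable_completion F(1)]) simp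
  moreover have "integrable lebesgue (\<lambda>\<xi>. (cmod (?G \<xi>))\<^sup>2)" using F(2) by (simp add: norm_mult)
  moreover have "AE \<xi> in lebesgue. \<xi> \<notin> \<Omega> \<longrightarrow> ?G \<xi> = 0" using F(3) by eventually_elim auto
  moreover have "(\<lambda>x. f (x - z)) = fourier_transform ?G"
  proof
    fix x
    have "cis (- 2 * pi * ((x - z) \<bullet> \<xi>)) = cis (- 2 * pi * (x \<bullet> \<xi>)) * cis (2 * pi * (z \<bullet> \<xi>))" for \<xi>
      by (simp add: cis_mult inner_diff_left algebra_simps)
    then show "f (x - z) = fourier_transform ?G x"
      unfolding f fourier_transform_def by (simp only: mult.assoc)
  qed
  ultimately show ?thesis unfolding PW2_def by blast
qed

text \<open>Testing against the translates of the Fourier transform of the indicator function of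
  \<open>\<Omega>\<close>, which does not vanish near \<open>0\<close>.\<close>

lemma sampling_set_locally_bounded:
  fixes \<Omega> :: "'a::euclidean_space set"
  assumes \<Omega>: "bounded \<Omega>" "\<Omega> \<in> sets lebesgue" "emeasure lebesgue \<Omega> > 0"
    and samp: "sampling_set \<Omega> \<Lambda>"
  shows "locally_bounded_measure (count_space \<Lambda>)"
proof -
  obtain B where B: "B > 0" "\<And>f. f \<in> PW2 \<Omega> \<Longrightarrow>
      (\<integral>\<^sup>+l. ennreal ((cmod (f l))\<^sup>2) \<partial>count_space \<Lambda>) \<le> ennreal B * L2_norm_sq f"
    using samp unfolding sampling_set_def by blast
  obtain C where C: "C > 0" "\<And>f. f \<in> PW2 \<Omega> \<Longrightarrow> f \<in> borel_measurable borel"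
    "\<And>f. f \<in> PW2 \<Omega> \<Longrightarrow> L2_norm_sq f < \<infinity>"
    "\<And>f x y. f \<in> PW2 \<Omega> \<Longrightarrow> dist x y \<le> 1 \<Longrightarrow>
      ennreal ((cmod (f y - f x))\<^sup>2) \<le> ennreal (C * (dist x y)\<^sup>2) * decay_average f x"
    by (rule PW2_bounds[OF \<Omega>(1)]) (rule that)
  have fin: "emeasure lebesgue \<Omega> < \<infinity>"
    using \<Omega>(1,2) by (metis bounded_set_imp_lmeasurable fmeasurable_def mem_Collect_eq top.not_eq_extremum infinity_ennreal_def fmeasurableD2)
  define f where "f = fourier_transform (\<lambda>\<xi>. indicator \<Omega> \<xi> :: complex)"
  have ind: "integrable lebesgue (\<lambda>\<xi>. indicator \<Omega> \<xi> :: real)"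
    using \<Omega>(2) fin by (intro integrable_real_indicator) auto
  have "(\<lambda>\<xi>. (cmod (indicator \<Omega> \<xi>))\<^sup>2) = (\<lambda>\<xi>. indicator \<Omega> \<xi> :: real)"
    by (auto simp: indicator_def)
  then have f: "f \<in> PW2 \<Omega>"
    unfolding f_def PW2_def using ind \<Omega>(2) by (intro imageI) (auto intro!: borel_measurable_indicator)
  \<comment> \<open>\<open>a\<close> is the value of \<open>f\<close> at 0; it is positive because
    \<Omega> has positive measure.\<close>
  define a where "a = measure lebesgue \<Omega>"
  have a: "a > 0"
    using \<Omega>(3) fin by (simp add: a_def measure_def enn2real_positive_iff)
  have "f 0 = of_real (LINT \<xi>|lebesgue. indicator \<Omega> \<xi>)"
    unfolding f_def fourier_transform_def integral_complex_of_real[symmetric]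
    by (intro Bochner_Integration.integral_cong) (auto simp: indicator_def)
  then have f0: "f 0 = of_real a"
    using \<Omega>(2) by (simp add: a_def)
  obtain N where N: "L2_norm_sq f = ennreal N" "N \<ge> 0"
    using C(3)[OF f] by (cases "L2_norm_sq f") auto
  \<comment> \<open>Within distance \<rho> of 0 the oscillation of \<open>f\<close> is at most
    \<open>\<rho> * sqrt (C * N + 1)\<close>, hence at most half of \<open>f 0\<close>. The 1 under
    the root prevents division by 0.\<close>
  define \<rho> where "\<rho> = min 1 (a / (2 * sqrt (C * N + 1)))"
  have s: "sqrt (C * N + 1) > 0" using C(1) N(2) by (simp add: add_nonneg_pos)
  have \<rho>: "\<rho> > 0" "\<rho> \<le> 1" "\<rho> * sqrt (C * N + 1) \<le> a / 2"
  proof -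
    show "\<rho> > 0" "\<rho> \<le> 1" using a s by (auto simp: \<rho>_def)
    have "\<rho> * sqrt (C * N + 1) \<le> a / (2 * sqrt (C * N + 1)) * sqrt (C * N + 1)"
      using s by (intro mult_right_mono) (auto simp: \<rho>_def)
    then show "\<rho> * sqrt (C * N + 1) \<le> a / 2" using s by simp
  qed
  have big: "(a / 2)\<^sup>2 \<le> (cmod (f y))\<^sup>2" if y: "dist 0 y < \<rho>" for y
  proof -
    have "ennreal ((cmod (f y - f 0))\<^sup>2) \<le> ennreal (C * (dist 0 y)\<^sup>2) * decay_average f 0"
      using y \<rho> by (intro C(4)[OF f]) auto
    also have "\<dots> \<le> ennreal (C * (dist 0 y)\<^sup>2) * ennreal N"
      unfolding N(1)[symmetric] L2_norm_sq_lborel by (intro mult_left_mono decay_average_le) simp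
    also have "\<dots> = ennreal ((dist 0 y)\<^sup>2 * (C * N))"
      using C(1) N(2) by (simp add: ennreal_mult[symmetric] mult_ac)
    finally have "(cmod (f y - f 0))\<^sup>2 \<le> (dist 0 y)\<^sup>2 * (C * N)"
      using C(1) N(2) by (subst (asm) ennreal_le_iff) auto
    also have "\<dots> \<le> \<rho>\<^sup>2 * (C * N + 1)"
      using y C(1) N(2) by (intro mult_mono power_mono) auto
    also have "\<dots> = (\<rho> * sqrt (C * N + 1))\<^sup>2"
      using C(1) N(2) by (simp add: power_mult_distrib)
    also have "\<dots> \<le> (a / 2)\<^sup>2"
      using \<rho> s by (intro power_mono) auto
    finally have "cmod (f y - f 0) \<le> a / 2"
      using a by (simp add: power2_le_iff_abs_le)
    moreover have "cmod (f 0) \<le> cmod (f y) + cmod (f y - f 0)"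
      using norm_triangle_ineq4[of "f y" "f y - f 0"] by simp
    ultimately have "a / 2 \<le> cmod (f y)" using a by (simp add: f0)
    then show ?thesis using a by (intro power_mono) auto
  qed
  have "emeasure (count_space \<Lambda>) (ball z \<rho> \<inter> \<Lambda>) \<le> ennreal (B * N / (a / 2)\<^sup>2)" for z
  proof -
    \<comment> \<open>Every point of \<Lambda> in the ball contributes at least (a / 2)^2 to the sum
      for the translate of \<open>f\<close> by \<open>z\<close>, and the norm of that translate does
      not depend on \<open>z\<close>.\<close>
    have "ennreal ((a / 2)\<^sup>2) * emeasure (count_space \<Lambda>) (ball z \<rho> \<inter> \<Lambda>)
        = (\<integral>\<^sup>+l. ennreal ((a / 2)\<^sup>2) * indicator (ball z \<rho> \<inter> \<Lambda>) l \<partial>count_space \<Lambda>)"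
      by (rule nn_integral_cmult_indicator[symmetric]) auto
    also have "\<dots> \<le> (\<integral>\<^sup>+l. ennreal ((cmod (f (l - z)))\<^sup>2) \<partial>count_space \<Lambda>)"
      by (intro nn_integral_mono)
         (auto simp: indicator_def dist_norm norm_minus_commute intro!: ennreal_leI big)
    also have "\<dots> \<le> ennreal B * L2_norm_sq (\<lambda>x. f (x - z))"
      by (rule B(2)[OF PW2_translate[OF f]])
    also have "L2_norm_sq (\<lambda>x. f (x - z)) = ennreal N"
      unfolding N(1)[symmetric] L2_norm_sq_lborel
      using nn_integral_plus_left[of "\<lambda>x. ennreal ((cmod (f x))\<^sup>2)" "- z"] C(2)[OF f] by simp
    finally have "ennreal ((a / 2)\<^sup>2) * emeasure (count_space \<Lambda>) (ball z \<rho> \<inter> \<Lambda>) \<le> ennreal (B * N)"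
      using B(1) N(2) by (simp add: ennreal_mult)
    then have "ennreal (1 / (a / 2)\<^sup>2) * (ennreal ((a / 2)\<^sup>2) * emeasure (count_space \<Lambda>) (ball z \<rho> \<inter> \<Lambda>))
        \<le> ennreal (1 / (a / 2)\<^sup>2) * ennreal (B * N)"
      by (rule mult_left_mono) simp
    moreover have "ennreal (1 / (a / 2)\<^sup>2) * ennreal ((a / 2)\<^sup>2) = 1"
      using a by (subst ennreal_mult[symmetric]) auto
    moreover have "ennreal (1 / (a / 2)\<^sup>2) * ennreal (B * N) = ennreal (B * N / (a / 2)\<^sup>2)"
      using a B(1) N(2) by (subst ennreal_mult[symmetric]) auto
    ultimately show ?thesis by (simp only: mult.assoc[symmetric] mult_1)
  qed
  then show ?thesis
    using \<rho>(1) by (intro locally_bounded_measureI) auto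
qed

text \<open>Zorn's lemma on the r-separated subsets: a point of \<Gamma> at distance at least r from
  a maximal one could be adjoined to it.\<close>

lemma maximal_separated_subset:
  fixes \<Gamma> :: "'a::metric_space set"
  obtains \<Lambda> where "\<Lambda> \<subseteq> \<Gamma>" "\<And>x y. x \<in> \<Lambda> \<Longrightarrow> y \<in> \<Lambda> \<Longrightarrow> x \<noteq> y \<Longrightarrow> r \<le> dist x y"
    "\<And>x. r > 0 \<Longrightarrow> x \<in> \<Gamma> \<Longrightarrow> \<exists>l\<in>\<Lambda>. dist l x < r"
proof -
  define S where "S = {A. A \<subseteq> \<Gamma> \<and> (\<forall>x\<in>A. \<forall>y\<in>A. x \<noteq> y \<longrightarrow> r \<le> dist x y)}"
  have "\<exists>M\<in>S. \<forall>X\<in>S. M \<subseteq> X \<longrightarrow> X = M"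
  proof (rule subset_Zorn')
    fix C assume C: "subset.chain S C"
    show "\<Union>C \<in> S"
      unfolding S_def
    proof (intro CollectI conjI ballI impI)
      show "\<Union>C \<subseteq> \<Gamma>" using C by (auto simp: subset_chain_def S_def)
      fix x y assume "x \<in> \<Union>C" "y \<in> \<Union>C" "x \<noteq> y"
      then obtain X Y where XY: "X \<in> C" "Y \<in> C" "x \<in> X" "y \<in> Y" by blast
      then have "X \<subseteq> Y \<or> Y \<subseteq> X" using C by (auto simp: subset_chain_def)
      then obtain Z where "Z \<in> C" "x \<in> Z" "y \<in> Z" using XY by blast
      then show "r \<le> dist x y" using C \<open>x \<noteq> y\<close> by (auto simp: subset_chain_def S_def)
    qed
  qed
  then obtain \<Lambda> where \<Lambda>: "\<Lambda> \<in> S" and max: "\<And>X. X \<in> S \<Longrightarrow> \<Lambda> \<subseteq> X \<Longrightarrow> X = \<Lambda>" by blast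
  show thesis
  proof (rule that)
    show "\<Lambda> \<subseteq> \<Gamma>" using \<Lambda> by (simp add: S_def)
    show "r \<le> dist x y" if "x \<in> \<Lambda>" "y \<in> \<Lambda>" "x \<noteq> y" for x y
      using \<Lambda> that by (simp add: S_def)
    fix x assume "r > 0" "x \<in> \<Gamma>"
    show "\<exists>l\<in>\<Lambda>. dist l x < r"
    proof (rule ccontr)
      assume *: "\<not> (\<exists>l\<in>\<Lambda>. dist l x < r)"
      then have "insert x \<Lambda> \<in> S"
        using \<Lambda> \<open>x \<in> \<Gamma>\<close> by (auto simp: S_def dist_commute not_less)
      then have "x \<in> \<Lambda>" using max[of "insert x \<Lambda>"] by blast
      then show False using * \<open>r > 0\<close> by auto
    qed
  qed
qed

text \<open>\<open>traj_measure\<close> counts only the part of a Borel set inside \<Gamma>. Since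
  \<Gamma> may fail to be Borel, concentration on \<Gamma> is expressed through closed sets that
  miss it.\<close>

lemma AE_traj_measure:
  assumes "closed N" "N \<inter> \<Gamma> = {}"
  shows "AE x in traj_measure \<Gamma>. x \<notin> N"
proof (rule AE_I)
  show "emeasure (traj_measure \<Gamma>) N = 0"
    using assms by (subst emeasure_traj_measure) auto
qed (use assms in auto)

theorem theoremD:
  fixes \<Gamma> \<Omega> :: "'a::euclidean_space set"
  assumes "trajectory \<Gamma>" and "regular_set \<Gamma>"
    and "bounded \<Omega>" and "\<Omega> \<in> sets lebesgue" and "emeasure lebesgue \<Omega> > 0"
  shows "(sampling_trajectory \<Omega> \<Gamma> \<longleftrightarrow> (\<exists>\<Lambda>\<subseteq>\<Gamma>. sampling_set \<Omega> \<Lambda>)) \<and>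
         (sampling_trajectory \<Omega> \<Gamma> \<longrightarrow> (\<exists>\<Lambda>\<subseteq>\<Gamma>. uniform_discrete \<Lambda> \<and> sampling_set \<Omega> \<Lambda>))"
proof -
  note \<Omega> = assms(3-5)
  have traj: "locally_bounded_measure (traj_measure \<Gamma>)"
    by (rule traj_measure_locally_bounded[OF assms(2)])
  have discretize: "\<exists>\<Lambda>\<subseteq>\<Gamma>. uniform_discrete \<Lambda> \<and> sampling_set \<Omega> \<Lambda>" if "sampling_trajectory \<Omega> \<Gamma>"
  proof -
    have "sampling_measure \<Omega> (traj_measure \<Gamma>)"
      using that by (simp add: sampling_trajectory_eq)
    then obtain r where r: "r > 0"
      "\<And>s c \<mu>. 0 < s \<Longrightarrow> s \<le> r \<Longrightarrow> 0 < c \<Longrightarrow> locally_bounded_measure \<mu> \<Longrightarrow>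
        (AE x in traj_measure \<Gamma>. ennreal c \<le> emeasure \<mu> (ball x s \<inter> space \<mu>)) \<Longrightarrow> sampling_measure \<Omega> \<mu>"
      by (rule sampling_measure_transfer[OF \<Omega>(1) traj]) (rule that)
    obtain \<Lambda> where \<Lambda>: "\<Lambda> \<subseteq> \<Gamma>" "\<And>x y. x \<in> \<Lambda> \<Longrightarrow> y \<in> \<Lambda> \<Longrightarrow> x \<noteq> y \<Longrightarrow> r \<le> dist x y"
      "\<And>x. r > 0 \<Longrightarrow> x \<in> \<Gamma> \<Longrightarrow> \<exists>l\<in>\<Lambda>. dist l x < r"
      by (rule maximal_separated_subset) (rule that)
    \<comment> \<open>The covering property holds on \<Gamma> only. The uncovered set is closed,
      being the complement of a union of open balls, and misses \<Gamma>, so it is null.\<close>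
    have "AE x in traj_measure \<Gamma>. x \<notin> - (\<Union>l\<in>\<Lambda>. ball l r)"
    proof (rule AE_traj_measure)
      show "closed (- (\<Union>l\<in>\<Lambda>. ball l r))" by (intro closed_Compl open_UN ballI open_ball)
      show "- (\<Union>l\<in>\<Lambda>. ball l r) \<inter> \<Gamma> = {}"
        using \<Lambda>(3)[OF r(1)] by (fastforce simp: mem_ball)
    qed
    then have "AE x in traj_measure \<Gamma>. ennreal 1 \<le> emeasure (count_space \<Lambda>) (ball x r \<inter> space (count_space \<Lambda>))"
    proof eventually_elim
      case (elim x)
      then obtain l where "l \<in> \<Lambda>" "l \<in> ball x r" by (auto simp: dist_commute)
      then have "emeasure (count_space \<Lambda>) {l} \<le> emeasure (count_space \<Lambda>) (ball x r \<inter> \<Lambda>)"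
        by (intro emeasure_mono) auto
      then show ?case using \<open>l \<in> \<Lambda>\<close> by simp
    qed
    then have "sampling_set \<Omega> \<Lambda>"
      unfolding sampling_set_eq
      using r(2)[of r 1 "count_space \<Lambda>"] r(1) count_space_locally_bounded[OF r(1) \<Lambda>(2)] by simp
    moreover have "uniform_discrete \<Lambda>"
      unfolding uniform_discrete_def using r(1) \<Lambda>(2) by (meson not_less)
    ultimately show ?thesis using \<Lambda>(1) by blast
  qed
  have "sampling_trajectory \<Omega> \<Gamma>" if \<Lambda>: "\<Lambda> \<subseteq> \<Gamma>" "sampling_set \<Omega> \<Lambda>" for \<Lambda>
  proof -
    have "sampling_measure \<Omega> (count_space \<Lambda>)"
      using \<Lambda>(2) by (simp add: sampling_set_eq)
    \<comment> \<open>\<Lambda> is an arbitrary sampling subset here, so its local boundedness is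
      drawn from the sampling inequality and not from separation.\<close>
    then obtain r where r: "r > 0"
      "\<And>s c \<mu>. 0 < s \<Longrightarrow> s \<le> r \<Longrightarrow> 0 < c \<Longrightarrow> locally_bounded_measure \<mu> \<Longrightarrow>
        (AE x in count_space \<Lambda>. ennreal c \<le> emeasure \<mu> (ball x s \<inter> space \<mu>)) \<Longrightarrow> sampling_measure \<Omega> \<mu>"
      by (rule sampling_measure_transfer[OF \<Omega>(1) sampling_set_locally_bounded[OF \<Omega> \<Lambda>(2)]]) (rule that)
    obtain r0 where r0: "r0 > 0"
      "\<And>r. 0 < r \<and> r \<le> r0 \<Longrightarrow> \<exists>c::real. c > 0 \<and> (INF x\<in>\<Gamma>. emeasure (traj_measure \<Gamma>) (ball x r)) \<ge> ennreal c"
      using assms(2) unfolding regular_set_def by blast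
    \<comment> \<open>One bound admits the radius in the transfer, the other in the lower mass bound
      of regularity; the resulting \<open>c\<close> may depend on \<open>s\<close>.\<close>
    define s where "s = min r r0"
    have s: "0 < s" "s \<le> r" "s \<le> r0" using r(1) r0(1) by (auto simp: s_def)
    obtain c where c: "c > 0" "ennreal c \<le> (INF x\<in>\<Gamma>. emeasure (traj_measure \<Gamma>) (ball x s))"
      using r0(2)[of s] s by blast
    have "ennreal c \<le> emeasure (traj_measure \<Gamma>) (ball x s)" if "x \<in> \<Lambda>" for x
      using that \<Lambda>(1) by (intro order_trans[OF c(2)] INF_lower) auto
    then have "AE x in count_space \<Lambda>. ennreal c \<le> emeasure (traj_measure \<Gamma>) (ball x s \<inter> space (traj_measure \<Gamma>))"
      by (simp add: AE_count_space)
    then show ?thesis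
      unfolding sampling_trajectory_eq by (rule r(2)[OF s(1,2) c(1) traj])
  qed
  with discretize show ?thesis by blast
qed

end
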